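(* Let $q_1$ be a power of $2$, $q=q_1^2$, and let $m$ be even. Let $n=q^m-1$ and let $\beta$ be a primitive $n$-th root of unity in $\mathbb{F}_{q^m}$. Put $\delta=q_1^{m+1}-q_1^2+1$ and assume $\delta\ge 2$. Let $g(x)$ be the generator polynomial of the BCH code $\mathcal{C}_{(q,n,\delta,1,\beta)}$ and $g^{\perp_H}(x)$ the generator polynomial of its Hermitian dual $\mathcal{C}_{(q,n,\delta,1,\beta)}^{\perp_H}$. Let $\mathcal{C}'$ denote the cyclic code of length $2n$ over $\mathbb{F}_q$ with generator polynomial $g(x)g^{\perp_H}(x)$. Then $\mathcal{C}'$ is a Hermitian self-dual cyclic code with parameters (i) $[2(q^m-1),\,q^m-1,\,d]_q$ with $d\ge q_1^{m+1}-q_1^2+2$, if $m\ge 4$; (ii) $[2(q^2-1),\,q^2-1,\,d]_q$ with $d\ge q_1^3-q_1^2+q_1+1$, if $m=2$.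
   Context: An $[n,k,d]_q$ code is a $k$-dimensional linear subspace of $\mathbb{F}_q^n$ with minimum Hamming distance $d$. For $q=q_1^2$, the Hermitian inner product on $\mathbb{F}_q^n$ is $\langle x,y\rangle_H=\sum_i x_iy_i^{q_1}$, the Hermitian dual is $\mathcal{C}^{\perp_H}=\{c\in\mathbb{F}_q^n:\langle c,y\rangle_H=0\ \forall y\in\mathcal{C}\}$, and $\mathcal{C}$ is Hermitian self-dual if $\mathcal{C}=\mathcal{C}^{\perp_H}$. A cyclic code of length $N$ over $\mathbb{F}_q$ is identified with an ideal of $\mathbb{F}_q[x]/\langle x^N-1\rangle$ via $(c_0,\dots,c_{N-1})\mapsto c_0+c_1x+\dots+c_{N-1}x^{N-1}$; its generator polynomial is the unique monic divisor of $x^N-1$ generating it. For $\gcd(n,q)=1$ and $\beta$ a primitive $n$-th root of unity, $m_{\beta^i}(x)$ denotes the minimal polynomial of $\beta^i$ over $\mathbb{F}_q$. For integers $\delta\ge2$ and $b$, the BCH code $\mathcal{C}_{(q,n,\delta,b,\beta)}$ is the cyclic code of length $n$ over $\mathbb{F}_q$ with generator polynomial $\mathrm{lcm}\{m_{\beta^b}(x),\dots,m_{\beta^{b+\delta-2}}(x)\}$. *)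

theory Defs
  imports
    "Jordan_Normal_Form.VS_Connect"
    "HOL-Algebra.QuotRing"
    "HOL-Library.Cardinality"
begin

section \<open>Linear codes and their parameters\<close>

definition hamming_dist :: "'a vec \<Rightarrow> 'a vec \<Rightarrow> nat" where
  "hamming_dist u v = card {i. i < dim_vec u \<and> u $ i \<noteq> v $ i}"

definition min_dist :: "'a vec set \<Rightarrow> nat" where
  "min_dist C = Min {hamming_dist u v | u v. u \<in> C \<and> v \<in> C \<and> u \<noteq> v}"

text \<open>An \<open>[N, k, d]\<close> code. The minimum distance is only meaningful for a code with at
  least two words, so the zero code has no parameters here.\<close>

definition is_code :: "nat \<Rightarrow> nat \<Rightarrow> nat \<Rightarrow> 'a::field vec set \<Rightarrow> bool" where
  "is_code N k d C \<longleftrightarrow>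
     subspace class_ring C (module_vec TYPE('a) N) \<and>
     vectorspace.dim class_ring ((module_vec TYPE('a) N)\<lparr>carrier := C\<rparr>) = k \<and>
     C \<noteq> {0\<^sub>v N} \<and> min_dist C = d"


section \<open>Hermitian duality\<close>

definition hermitian_prod :: "nat \<Rightarrow> 'a::field vec \<Rightarrow> 'a vec \<Rightarrow> 'a" where
  "hermitian_prod q1 x y = x \<bullet> map_vec (\<lambda>a. a ^ q1) y"

definition hermitian_dual :: "nat \<Rightarrow> nat \<Rightarrow> 'a::field vec set \<Rightarrow> 'a vec set" where
  "hermitian_dual q1 N C = {c \<in> carrier_vec N. \<forall>y\<in>C. hermitian_prod q1 c y = 0}"

definition hermitian_self_dual :: "nat \<Rightarrow> nat \<Rightarrow> 'a::field vec set \<Rightarrow> bool" where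
  "hermitian_self_dual q1 N C \<longleftrightarrow> C = hermitian_dual q1 N C"


section \<open>Cyclic codes\<close>

text \<open>The ring \<open>F[x] / (x^N - 1)\<close>; its elements are cosets, i.e. sets of polynomials.\<close>

definition cyc_ideal :: "nat \<Rightarrow> 'a::field poly set" where
  "cyc_ideal N = cgenideal class_ring (monom 1 N - 1)"

definition cyc_ring :: "nat \<Rightarrow> 'a::field poly set ring" where
  "cyc_ring N = class_ring Quot (cyc_ideal N)"

definition cyc_class :: "nat \<Rightarrow> 'a::field poly \<Rightarrow> 'a poly set" where
  "cyc_class N p = cyc_ideal N +>\<^bsub>class_ring\<^esub> p"

definition word_poly :: "'a::field vec \<Rightarrow> 'a poly" where
  "word_poly c = (\<Sum>i<dim_vec c. monom (c $ i) i)"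

definition code_classes :: "nat \<Rightarrow> 'a::field vec set \<Rightarrow> 'a poly set set" where
  "code_classes N C = (\<lambda>c. cyc_class N (word_poly c)) ` C"

definition is_cyclic_code :: "nat \<Rightarrow> 'a::field vec set \<Rightarrow> bool" where
  "is_cyclic_code N C \<longleftrightarrow> C \<subseteq> carrier_vec N \<and> ideal (code_classes N C) (cyc_ring N)"

definition is_generator_poly :: "nat \<Rightarrow> 'a::field vec set \<Rightarrow> 'a poly \<Rightarrow> bool" where
  "is_generator_poly N C g \<longleftrightarrow>
     lead_coeff g = 1 \<and> g dvd monom 1 N - 1 \<and>
     code_classes N C = cgenideal (cyc_ring N) (cyc_class N g)"

definition generator_poly :: "nat \<Rightarrow> 'a::field vec set \<Rightarrow> 'a poly" where
  "generator_poly N C = (THE g. is_generator_poly N C g)"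

text \<open>The words of length \<open>N\<close> corresponding to the ideal generated by \<open>g\<close>. This is the cyclic
  code with generator polynomial \<open>g\<close> if \<open>g\<close> is a monic divisor of \<open>x^N - 1\<close>.\<close>

definition cyclic_code :: "nat \<Rightarrow> 'a::field poly \<Rightarrow> 'a vec set" where
  "cyclic_code N g =
     {c \<in> carrier_vec N. cyc_class N (word_poly c) \<in> cgenideal (cyc_ring N) (cyc_class N g)}"


section \<open>BCH codes\<close>

definition primitive_root_of_unity :: "nat \<Rightarrow> 'b::field \<Rightarrow> bool" where
  "primitive_root_of_unity n \<beta> \<longleftrightarrow> \<beta> ^ n = 1 \<and> (\<forall>k. 0 < k \<and> k < n \<longrightarrow> \<beta> ^ k \<noteq> 1)"

text \<open>The extension of the base field \<open>'a\<close> by \<open>'b\<close> is given by an embedding \<open>\<phi>\<close>.\<close>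

definition minimal_poly :: "('a::field \<Rightarrow> 'b::field) \<Rightarrow> 'b \<Rightarrow> 'a poly" where
  "minimal_poly \<phi> x = (THE p. lead_coeff p = 1 \<and> poly (map_poly \<phi> p) x = 0 \<and>
     (\<forall>r. r \<noteq> 0 \<and> poly (map_poly \<phi> r) x = 0 \<longrightarrow> degree p \<le> degree r))"

text \<open>The library's \<^const>\<open>Lcm\<close> for polynomials needs the coefficients to be in the class
  \<^class>\<open>field_gcd\<close>; the monic least common multiple is defined here over any field.\<close>

definition poly_lcm :: "'a::field poly set \<Rightarrow> 'a poly" where
  "poly_lcm A = (THE p. lead_coeff p = 1 \<and> (\<forall>f\<in>A. f dvd p) \<and>
     (\<forall>h. (\<forall>f\<in>A. f dvd h) \<longrightarrow> p dvd h))"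

definition bch_code ::
  "('a::field \<Rightarrow> 'b::field) \<Rightarrow> nat \<Rightarrow> int \<Rightarrow> int \<Rightarrow> 'b \<Rightarrow> 'a vec set" where
  "bch_code \<phi> n \<delta> b \<beta> =
     cyclic_code n (poly_lcm ((\<lambda>i. minimal_poly \<phi> (\<beta> powi i)) ` {b..b + \<delta> - 2}))"

end

theory Submission
  imports Defs "Jordan_Normal_Form.Char_Poly"
begin

text \<open>Write \<open>x^n - 1 = g h\<close>. The Hermitian dual of the code generated by \<open>g\<close> is generated by the
  conjugate reciprocal of \<open>h\<close>, so \<open>g'\<close> is this polynomial made monic; put \<open>x^n - 1 = g' h'\<close>. In
  characteristic 2, \<open>x^(2n) - 1 = (g g') (h h')\<close>, and conjugate reciprocation maps \<open>h h'\<close> to \<open>g' g\<close>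
  up to a unit, which gives self-duality and the dimension.

  For the distance, let \<open>D = \<delta> - 1\<close>. The zeros of \<open>g\<close> are the \<open>\<beta>^(i q^l)\<close> with \<open>1 \<le> i \<le> D\<close>,
  and \<open>\<beta>^j\<close> is a zero of \<open>g'\<close> unless \<open>n\<close> divides some \<open>j + q1^(2l+1) i\<close>. Size estimates exclude
  this for all \<open>j \<le> D\<close>, and for \<open>m = 2\<close> even for \<open>j < D + q1\<close>. Hence \<open>\<beta>, ..., \<beta>^D\<close> are double
  zeros of every codeword and \<open>\<beta>^0\<close> is a further zero. A word \<open>A + x^n B\<close> has at least the weight of
  \<open>A + B\<close>, to which the BCH bound applies; if \<open>A + B = 0\<close>, its weight is twice that of \<open>B\<close>, which
  inherits the zeros \<open>\<beta>, ..., \<beta>^D\<close>.\<close>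

section \<open>Cyclic codes\<close>

abbreviation cyc_mod :: "nat \<Rightarrow> 'a::field poly" where
  "cyc_mod N \<equiv> monom 1 N - 1"

lemma coeff_word_poly: "coeff (word_poly c) i = (if i < dim_vec c then c $ i else 0)"
  by (simp add: word_poly_def coeff_sum)

lemma degree_word_poly: "N > 0 \<Longrightarrow> c \<in> carrier_vec N \<Longrightarrow> degree (word_poly c) < N"
  by (rule degree_lessI) (auto simp: coeff_word_poly)

lemma word_poly_vec: "degree p < N \<Longrightarrow> word_poly (vec N (coeff p)) = p"
  by (auto simp: poly_eq_iff coeff_word_poly coeff_eq_0)

lemma word_poly_eq_iff:
  "u \<in> carrier_vec N \<Longrightarrow> v \<in> carrier_vec N \<Longrightarrow> word_poly u = word_poly v \<longleftrightarrow> u = v"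
  by (metis carrier_vecD coeff_word_poly eq_vecI)

lemma degree_cyc_mod [simp]: "N > 0 \<Longrightarrow> degree (cyc_mod N :: 'a::field poly) = N"
  by (subst diff_conv_add_uminus, subst degree_add_eq_left) (auto simp: degree_monom_eq)

lemma cyc_mod_nonzero [simp]: "N > 0 \<Longrightarrow> (cyc_mod N :: 'a::field poly) \<noteq> 0"
  using degree_cyc_mod[of N, where 'a='a] by fastforce

lemma poly_cyc_mod [simp]: "poly (cyc_mod N) x = x ^ N - 1"
  by (simp add: poly_monom)

lemma cyc_ideal_eq: "cyc_ideal N = {p :: 'a::field poly. cyc_mod N dvd p}"
  by (auto simp: cyc_ideal_def cgenideal_def dvd_def mult.commute)

lemma cyc_class_eq: "cyc_class N p = {r :: 'a::field poly. cyc_mod N dvd r - p}"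
proof -
  have "cyc_class N p = (\<lambda>u. u + p) ` {u. cyc_mod N dvd u}"
    by (auto simp: cyc_class_def a_r_coset_def' cyc_ideal_eq)
  also have "\<dots> = {r. cyc_mod N dvd r - p}"
    by (force intro: image_eqI[of _ _ "x - p" for x])
  finally show ?thesis .
qed

lemma cyc_class_eq_iff: "cyc_class N p = cyc_class N r \<longleftrightarrow> cyc_mod N dvd p - (r :: 'a::field poly)"
proof
  assume "cyc_class N p = cyc_class N r"
  moreover have "p \<in> cyc_class N p" by (simp add: cyc_class_eq)
  ultimately show "cyc_mod N dvd p - r" by (simp add: cyc_class_eq)
next
  assume *: "cyc_mod N dvd p - r"
  have "cyc_mod N dvd x - p \<longleftrightarrow> cyc_mod N dvd x - r" for x
    using dvd_add_left_iff[OF *, of "x - p"] by simp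
  then show "cyc_class N p = cyc_class N r" by (simp add: cyc_class_eq)
qed

lemma cyc_ideal_ideal: "ideal (cyc_ideal N :: 'a::field poly set) class_ring"
  unfolding cyc_ideal_def by (rule cring.cgenideal_ideal[OF class_cring.is_cring]) simp

lemma cring_cyc_ring: "cring (cyc_ring N :: 'a::field poly set ring)"
  unfolding cyc_ring_def
  by (rule ideal.quotient_is_cring[OF cyc_ideal_ideal]) (rule class_cring.is_cring)

lemma carrier_cyc_ring: "carrier (cyc_ring N) = range (cyc_class N :: 'a::field poly \<Rightarrow> _)"
  by (auto simp: cyc_ring_def FactRing_def A_RCOSETS_def' cyc_class_def)

lemma cyc_class_mult:
  "cyc_class N p \<otimes>\<^bsub>cyc_ring N\<^esub> cyc_class N r = cyc_class N (p * r :: 'a::field poly)"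
  using ideal.rcoset_mult_add[OF cyc_ideal_ideal, of p r N]
  by (simp add: cyc_ring_def FactRing_def cyc_class_def)

lemma cgenideal_cyc_class:
  "cgenideal (cyc_ring N) (cyc_class N f) = {cyc_class N (u * f :: 'a::field poly) | u. True}"
  unfolding cgenideal_def carrier_cyc_ring cyc_class_mult[symmetric] by blast

text \<open>As \<open>f\<close> divides the modulus, all representatives of a coset agree modulo
  \<open>f\<close>, so divisibility by \<open>f\<close> is a property of the coset. This turns every
  question about ideals into one about divisors.\<close>

lemma cyc_class_in_cgenideal_iff:
  fixes f :: "'a::field poly"
  assumes "f dvd cyc_mod N"
  shows "cyc_class N p \<in> cgenideal (cyc_ring N) (cyc_class N f) \<longleftrightarrow> f dvd p"
proof
  assume "cyc_class N p \<in> cgenideal (cyc_ring N) (cyc_class N f)"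
  then obtain u where "cyc_mod N dvd p - u * f"
    by (auto simp: cgenideal_cyc_class cyc_class_eq_iff)
  with assms have "f dvd p - u * f" by (rule dvd_trans)
  then show "f dvd p" by (simp add: dvd_diff_left_iff)
next
  assume "f dvd p"
  then show "cyc_class N p \<in> cgenideal (cyc_ring N) (cyc_class N f)"
    by (auto simp: cgenideal_cyc_class dvd_def mult.commute)
qed

lemma mem_cyclic_code_iff:
  fixes f :: "'a::field poly"
  assumes "f dvd cyc_mod N"
  shows "c \<in> cyclic_code N f \<longleftrightarrow> c \<in> carrier_vec N \<and> f dvd word_poly c"
  using cyc_class_in_cgenideal_iff[OF assms] by (simp add: cyclic_code_def)

lemma code_classes_cyclic_code:
  fixes f :: "'a::field poly"
  assumes "N > 0"
  shows "code_classes N (cyclic_code N f) = cgenideal (cyc_ring N) (cyc_class N f)"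
proof
  show "cgenideal (cyc_ring N) (cyc_class N f) \<subseteq> code_classes N (cyclic_code N f)"
  proof
    fix K assume K: "K \<in> cgenideal (cyc_ring N) (cyc_class N f)"
    then obtain p where p: "K = cyc_class N p" by (auto simp: cgenideal_cyc_class)
    \<comment> \<open>The remainder modulo \<open>x^N - 1\<close> is a representative of degree
      below \<open>N\<close>, hence the polynomial of a word.\<close>
    define c where "c = vec N (coeff (p mod cyc_mod N))"
    have "degree (p mod cyc_mod N) < N"
      using degree_mod_less'[OF cyc_mod_nonzero[OF assms], of p] assms degree_cyc_mod[OF assms, where 'a='a]
      by (cases "p mod cyc_mod N = 0") simp_all
    then have "word_poly c = p mod cyc_mod N" by (simp add: c_def word_poly_vec)
    then have *: "K = cyc_class N (word_poly c)"
      by (simp add: p cyc_class_eq_iff minus_mod_eq_mult_div)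
    with K have "c \<in> cyclic_code N f" by (simp add: cyclic_code_def c_def)
    with * show "K \<in> code_classes N (cyclic_code N f)" by (auto simp: code_classes_def)
  qed
qed (auto simp: code_classes_def cyclic_code_def)

lemma is_cyclic_code_cyclic_code:
  fixes f :: "'a::field poly"
  assumes "N > 0"
  shows "is_cyclic_code N (cyclic_code N f)"
  unfolding is_cyclic_code_def code_classes_cyclic_code[OF assms]
  by (auto simp: cyclic_code_def carrier_cyc_ring intro!: cring.cgenideal_ideal[OF cring_cyc_ring])

lemma is_generator_poly_cyclic_code:
  fixes f :: "'a::field poly"
  assumes "N > 0" "lead_coeff f = 1" "f dvd cyc_mod N"
  shows "is_generator_poly N (cyclic_code N f) f"
  using assms by (simp add: is_generator_poly_def code_classes_cyclic_code)

lemma monic_dvd_antisym: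
  fixes p r :: "'a::field poly"
  assumes "p dvd r" "r dvd p" "lead_coeff p = 1" "lead_coeff r = 1"
  shows "p = r"
  using assms poly_dvd_antisym by metis

lemma generator_poly_cyclic_code:
  fixes f :: "'a::field poly"
  assumes "N > 0" "lead_coeff f = 1" "f dvd cyc_mod N"
  shows "generator_poly N (cyclic_code N f) = f"
  unfolding generator_poly_def
proof (rule the_equality)
  show "is_generator_poly N (cyclic_code N f) f" by (rule is_generator_poly_cyclic_code[OF assms])
next
  fix r assume r: "is_generator_poly N (cyclic_code N f) r"
  then have eq: "cgenideal (cyc_ring N) (cyc_class N f) = cgenideal (cyc_ring N) (cyc_class N r)"
    and rd: "r dvd cyc_mod N" "lead_coeff r = 1"
    using assms by (auto simp: is_generator_poly_def code_classes_cyclic_code)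
  \<comment> \<open>Each generator lies in the ideal of the other, so the two divide one
    another.\<close>
  have "f dvd r" "r dvd f"
    using cyc_class_in_cgenideal_iff[OF assms(3), of r] cyc_class_in_cgenideal_iff[OF rd(1), of r]
      cyc_class_in_cgenideal_iff[OF assms(3), of f] cyc_class_in_cgenideal_iff[OF rd(1), of f] eq
    by simp_all
  then show "r = f" using monic_dvd_antisym assms rd by blast
qed

section \<open>Hermitian duals\<close>

lemma reflect_poly_map_poly:
  fixes \<sigma> :: "'a::field \<Rightarrow> 'b::field"
  assumes "field_hom \<sigma>"
  shows "reflect_poly (map_poly \<sigma> p) = map_poly \<sigma> (reflect_poly p)"
proof -
  interpret field_hom \<sigma> by (rule assms)
  show ?thesis by (simp add: poly_eq_iff coeff_reflect_poly)
qed

lemma reflect_poly_monom_1 [simp]: "reflect_poly (monom (1::'a::field) j) = 1"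
  by (auto simp: poly_eq_iff coeff_reflect_poly degree_monom_eq)

lemma reflect_poly_cyc_mod: "N > 0 \<Longrightarrow> reflect_poly (cyc_mod N :: 'a::field poly) = - cyc_mod N"
  by (rule poly_eqI) (auto simp: coeff_reflect_poly)

text \<open>Reversing \<open>r\<close> turns the convolution of coefficients into a termwise
  pairing, so the Hermitian product of two words becomes a single coefficient of a product.\<close>

lemma coeff_mult_reflect_poly:
  fixes p r :: "'a::field poly"
  assumes "field_hom \<sigma>"
  shows "coeff (p * map_poly \<sigma> (reflect_poly r)) (degree r) = (\<Sum>i\<le>degree r. coeff p i * \<sigma> (coeff r i))"
proof -
  interpret field_hom \<sigma> by (rule assms)
  show ?thesis by (auto simp: coeff_mult coeff_reflect_poly intro!: sum.cong)
qed

lemma hermitian_prod_eq_coeff: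
  fixes c y :: "'a::field vec"
  assumes \<sigma>: "field_hom (\<lambda>a::'a. a ^ q1)" and N: "N > 0"
    and c: "c \<in> carrier_vec N" and y: "y \<in> carrier_vec N"
  shows "hermitian_prod q1 c y =
    coeff (word_poly c * map_poly (\<lambda>a. a ^ q1) (reflect_poly (word_poly y))) (degree (word_poly y))"
proof -
  interpret field_hom "\<lambda>a::'a. a ^ q1" by (rule \<sigma>)
  have "hermitian_prod q1 c y = (\<Sum>i<N. coeff (word_poly c) i * coeff (word_poly y) i ^ q1)"
    using c y by (simp add: hermitian_prod_def scalar_prod_def coeff_word_poly atLeast0LessThan)
  also have "\<dots> = (\<Sum>i\<le>degree (word_poly y). coeff (word_poly c) i * coeff (word_poly y) i ^ q1)"
    using degree_word_poly[OF N y] hom_zero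
    by (intro sum.mono_neutral_right) (auto simp: coeff_eq_0)
  finally show ?thesis by (simp add: coeff_mult_reflect_poly[OF \<sigma>])
qed

lemma cyc_mod_factor_reflect:
  fixes g h :: "'a::field poly"
  assumes "field_hom \<sigma>" and "N > 0" and gh: "g * h = cyc_mod N"
  shows "map_poly \<sigma> (reflect_poly g) * map_poly \<sigma> (reflect_poly h) = - cyc_mod N"
proof -
  interpret field_hom \<sigma> by (rule assms)
  interpret M: map_poly_idom_hom \<sigma> ..
  have "map_poly \<sigma> (reflect_poly g) * map_poly \<sigma> (reflect_poly h) = map_poly \<sigma> (reflect_poly (g * h))"
    by (simp add: reflect_poly_mult M.hom_mult)
  also have "\<dots> = - cyc_mod N"
    by (simp add: gh reflect_poly_cyc_mod assms M.hom_minus M.hom_uminus)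
  finally show ?thesis .
qed

text \<open>Let \<open>gs\<close> and \<open>hs\<close> be the conjugate reciprocals of
  \<open>g\<close> and \<open>h\<close>. The pairing of \<open>c\<close> with a shift
  \<open>x^j g\<close> is a coefficient of \<open>word_poly c * gs\<close>. Orthogonality to all
  shifts forces this product to vanish modulo \<open>x^N - 1 = - gs * hs\<close>, which means that
  \<open>hs\<close> divides \<open>word_poly c\<close>.\<close>

lemma hermitian_dual_cyclic_code:
  fixes g h :: "'a::field poly"
  assumes \<sigma>: "field_hom (\<lambda>a::'a. a ^ q1)" and N: "N > 0" and gh: "g * h = cyc_mod N"
  shows "hermitian_dual q1 N (cyclic_code N g) =
    cyclic_code N (map_poly (\<lambda>a. a ^ q1) (reflect_poly h))"
proof -
  interpret field_hom "\<lambda>a::'a. a ^ q1" by (rule \<sigma>)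
  interpret M: map_poly_idom_hom "\<lambda>a::'a. a ^ q1" ..
  interpret I: inj_zero_hom "\<lambda>a::'a. a ^ q1" ..
  let ?S = "map_poly (\<lambda>a::'a. a ^ q1)"
  define gs hs where "gs = ?S (reflect_poly g)" and "hs = ?S (reflect_poly h)"
  have gshs: "gs * hs = - cyc_mod N"
    unfolding gs_def hs_def by (rule cyc_mod_factor_reflect[OF \<sigma> N gh])
  then have cm: "cyc_mod N = - (gs * hs)" by simp
  from gshs have hs_dvd: "hs dvd cyc_mod N" and gs_dvd: "gs dvd cyc_mod N"
    by (metis dvd_minus_iff dvd_triv_right, metis dvd_minus_iff dvd_triv_left)
  have g_dvd: "g dvd cyc_mod N" using gh by (metis dvd_triv_left)
  \<comment> \<open>Nonzero constant terms make reflection preserve the degree.\<close>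
  have "coeff g 0 * coeff h 0 = - 1"
    using arg_cong[OF gh, of "\<lambda>p. coeff p 0"] N by (simp add: coeff_mult_0)
  then have g0: "coeff g 0 \<noteq> 0" and h0: "coeff h 0 \<noteq> 0" by auto
  have nz: "g \<noteq> 0" "h \<noteq> 0" "gs \<noteq> 0" "hs \<noteq> 0" using g0 h0 gshs N cyc_mod_nonzero[OF N, where 'a='a] by auto
  have deg_gs: "degree gs = degree g" and deg_hs: "degree hs = degree h"
    using g0 h0 by (simp_all add: gs_def hs_def)
  have deg: "degree g + degree h = N"
    using degree_mult_eq[OF nz(1,2)] gh degree_cyc_mod[OF N, where 'a='a] by simp
  have "c \<in> hermitian_dual q1 N (cyclic_code N g) \<longleftrightarrow> hs dvd word_poly c"
    if c: "c \<in> carrier_vec N" for c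
  proof
    assume dual: "c \<in> hermitian_dual q1 N (cyclic_code N g)"
    define P where "P = word_poly c * gs"
    define B where "B = poly_shift N P"
    have vanish: "coeff P t = 0" if t: "degree g \<le> t" "t < N" for t
    proof -
      \<comment> \<open>The test word \<open>x^j g\<close> has degree \<open>t\<close>. Its
        reciprocal is that of \<open>g\<close>, so the shift only selects which coefficient of
        \<open>P\<close> is read off.\<close>
      define j where "j = t - degree g"
      define y where "y = vec N (coeff (monom 1 j * g))"
      have dj: "degree (monom 1 j * g) = t"
        using t nz by (simp add: degree_mult_eq degree_monom_eq j_def)
      have wy: "word_poly y = monom 1 j * g" unfolding y_def
        by (rule word_poly_vec) (simp add: dj t)
      then have y: "y \<in> carrier_vec N" "y \<in> cyclic_code N g"
        by (simp_all add: y_def mem_cyclic_code_iff[OF g_dvd])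
      then have "0 = hermitian_prod q1 c y" using dual by (simp add: hermitian_dual_def)
      also have "\<dots> = coeff P t"
        by (simp add: hermitian_prod_eq_coeff[OF \<sigma> N c y(1)] wy dj reflect_poly_mult P_def gs_def)
      finally show ?thesis by simp
    qed
    have degP: "coeff P t = 0" if "t \<ge> N + degree g" for t
    proof (rule coeff_eq_0)
      have "degree P \<le> degree (word_poly c) + degree g"
        unfolding P_def deg_gs[symmetric] by (rule degree_mult_le)
      then show "degree P < t" using degree_word_poly[OF N c] that by simp
    qed
    \<comment> \<open>Reduction modulo \<open>x^N - 1\<close> moves the coefficients from
      \<open>N\<close> on down by \<open>N\<close>. What lands at \<open>degree g\<close> or above
      comes from positions where \<open>P\<close> vanishes, so \<open>Q\<close> is a multiple of
      \<open>gs\<close> without coefficients at or above the degree of \<open>gs\<close>.\<close>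
    define Q where "Q = P - cyc_mod N * B"
    have cQ: "coeff Q i = 0" if "i \<ge> degree g" for i
      using that vanish[of i] degP[of "i + N"]
      by (auto simp: Q_def B_def left_diff_distrib coeff_monom_mult coeff_poly_shift)
    have "gs dvd Q" unfolding Q_def P_def by (rule dvd_diff[OF _ dvd_mult2[OF gs_dvd]]) simp
    have "Q = 0"
    proof (rule ccontr)
      assume "Q \<noteq> 0"
      with \<open>gs dvd Q\<close> have "degree g \<le> degree Q" using dvd_imp_degree_le deg_gs by metis
      then have "lead_coeff Q = 0" by (rule cQ)
      with \<open>Q \<noteq> 0\<close> show False by simp
    qed
    then have "word_poly c * gs = - (gs * hs) * B" unfolding Q_def P_def cm by (simp only: right_minus_eq)
    then have "gs * word_poly c = gs * (- hs * B)" by (simp add: mult.commute mult.assoc)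
    then have "word_poly c = - hs * B" using nz by (metis mult_left_cancel)
    then show "hs dvd word_poly c" by simp
  next
    assume "hs dvd word_poly c"
    then obtain u where u: "word_poly c = hs * u" by (auto simp: dvd_def)
    have "hermitian_prod q1 c y = 0" if "y \<in> cyclic_code N g" for y
    proof (cases "word_poly c = 0 \<or> word_poly y = 0")
      case True
      then show ?thesis using that hermitian_prod_eq_coeff[OF \<sigma> N c]
        by (auto simp: mem_cyclic_code_iff[OF g_dvd])
    next
      case False
      have y: "y \<in> carrier_vec N" and "g dvd word_poly y"
        using that by (simp_all add: mem_cyclic_code_iff[OF g_dvd])
      then obtain v where v: "word_poly y = g * v" by (auto simp: dvd_def)
      define w where "w = u * ?S (reflect_poly v)"
      have u0: "u \<noteq> 0" and v0: "v \<noteq> 0" using False u v by auto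
      have dv: "degree (word_poly y) = degree g + degree v" using v0 nz by (simp add: v degree_mult_eq)
      \<comment> \<open>A word has degree below \<open>N\<close>, which bounds \<open>u\<close>.
        Then \<open>degree w < degree (word_poly y) < N\<close>, and at this degree neither
        \<open>monom 1 N * w\<close> nor \<open>w\<close> has a coefficient.\<close>
      have du: "degree u < degree g"
        using degree_word_poly[OF N c] u0 nz deg by (simp add: u degree_mult_eq deg_hs)
      have "degree w \<le> degree u + degree v" unfolding w_def
        by (rule order.trans[OF degree_mult_le]) (simp add: degree_reflect_poly_le)
      then have w: "degree w < degree (word_poly y)" using du dv by simp
      have "hermitian_prod q1 c y = coeff (hs * u * (gs * ?S (reflect_poly v))) (degree (word_poly y))"
        by (simp add: hermitian_prod_eq_coeff[OF \<sigma> N c y] u v reflect_poly_mult M.hom_mult gs_def)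
      also have "hs * u * (gs * ?S (reflect_poly v)) = - (cyc_mod N * w)"
        unfolding cm w_def by (simp add: mult_ac)
      also have "coeff (- (cyc_mod N * w)) (degree (word_poly y)) = 0"
        using w degree_word_poly[OF N y]
        by (simp add: left_diff_distrib coeff_monom_mult coeff_eq_0)
      finally show ?thesis .
    qed
    then show "c \<in> hermitian_dual q1 N (cyclic_code N g)"
      using c by (simp add: hermitian_dual_def)
  qed
  then show ?thesis
    using mem_cyclic_code_iff[OF hs_dvd] unfolding hs_def
    by (auto simp: hermitian_dual_def)
qed

section \<open>Dimension and minimum distance\<close>

lemma word_poly_zero [simp]: "word_poly (0\<^sub>v N) = (0 :: 'a::field poly)"
  by (simp add: poly_eq_iff coeff_word_poly)

text \<open>Multiplication by \<open>f\<close> is an injective linear map from the words of length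
  \<open>N - degree f\<close> onto the code, so rank-nullity gives the dimension.\<close>

lemma cyclic_code_linear:
  fixes f :: "'a::field poly"
  assumes N: "N > 0" and f: "f dvd cyc_mod N"
  shows "VectorSpace.subspace class_ring (cyclic_code N f) (module_vec TYPE('a) N)"
    and "vectorspace.dim class_ring ((module_vec TYPE('a) N)\<lparr>carrier := cyclic_code N f\<rparr>) = N - degree f"
proof -
  define k where "k = N - degree f"
  have f0: "f \<noteq> 0" using f cyc_mod_nonzero[OF N, where 'a='a] by (metis dvd_0_left_iff)
  have dk: "degree f + k = N"
    using dvd_imp_degree_le[OF f] degree_cyc_mod[OF N, where 'a='a] cyc_mod_nonzero[OF N, where 'a='a]
    by (simp add: k_def)
  define T where "T = (\<lambda>v. vec N (coeff (f * word_poly v)))"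
  have wT: "word_poly (T v) = f * word_poly v" if "v \<in> carrier_vec k" for v
  proof (cases "word_poly v = 0")
    case True
    then show ?thesis using word_poly_vec[of 0 N] N by (simp add: T_def)
  next
    case False
    then have "k > 0" using that by (cases k) (auto simp: word_poly_def)
    then show ?thesis unfolding T_def
      using degree_word_poly[OF _ that] False f0 dk
      by (intro word_poly_vec) (simp add: degree_mult_eq)
  qed
  have wadd: "word_poly (u + v) = word_poly u + word_poly v"
    if "u \<in> carrier_vec k" "v \<in> carrier_vec k" for u v :: "'a vec"
    using that by (auto simp: poly_eq_iff coeff_word_poly)
  have wsm: "word_poly (a \<cdot>\<^sub>v v) = Polynomial.smult a (word_poly v)" for a and v :: "'a vec"
    by (auto simp: poly_eq_iff coeff_word_poly)
  have hom: "T \<in> LinearCombinations.module_hom class_ring (module_vec TYPE('a) k) (module_vec TYPE('a) N)"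
    by (auto simp: LinearCombinations.module_hom_def module_vec_simps T_def wadd wsm ring_distribs)
  interpret V: vec_space "TYPE('a)" k .
  interpret W: vec_space "TYPE('a)" N .
  interpret L: linear_map class_ring "module_vec TYPE('a) k" "module_vec TYPE('a) N" T
    by (intro linear_map.intro mod_hom.intro mod_hom_axioms.intro vec_vs hom vec_module)
  have im: "L.imT = cyclic_code N f"
  proof
    show "L.imT \<subseteq> cyclic_code N f"
      by (auto simp: L.im_def module_vec_simps mem_cyclic_code_iff[OF f] wT) (simp add: T_def)
    show "cyclic_code N f \<subseteq> L.imT"
    proof
      fix c assume "c \<in> cyclic_code N f"
      then have c: "c \<in> carrier_vec N" and "f dvd word_poly c"
        by (simp_all add: mem_cyclic_code_iff[OF f])
      then obtain u where u: "word_poly c = f * u" by (auto simp: dvd_def)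
      define v where "v = vec k (coeff u)"
      have "word_poly v = u"
      proof (cases "u = 0")
        case True
        then show ?thesis by (simp add: v_def poly_eq_iff coeff_word_poly)
      next
        case False
        then show ?thesis using degree_word_poly[OF N c] f0 dk
          unfolding v_def by (intro word_poly_vec) (simp add: u degree_mult_eq)
      qed
      then have "T v = c" using c unfolding T_def u[symmetric]
        by (auto simp: u[symmetric] coeff_word_poly)
      moreover have "v \<in> carrier_vec k" by (simp add: v_def)
      ultimately show "c \<in> L.imT" by (auto simp: L.im_def module_vec_simps)
    qed
  qed
  have "v = 0\<^sub>v k" if "v \<in> L.kerT" for v
  proof -
    from that have v: "v \<in> carrier_vec k" and "T v = 0\<^sub>v N" by (auto simp: L.ker_def module_vec_simps)
    then have "f * word_poly v = word_poly (0\<^sub>v N)" using wT[OF v] by simp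
    then have "f * word_poly v = 0" by simp
    then have "word_poly v = word_poly (0\<^sub>v k)" using f0 by simp
    then show ?thesis using v word_poly_eq_iff zero_carrier_vec by metis
  qed
  moreover have "0\<^sub>v k \<in> L.kerT" using L.f0_is_0 by (simp add: L.ker_def module_vec_simps)
  ultimately have ker: "L.kerT = {0\<^sub>v k}" by blast
  show "VectorSpace.subspace class_ring (cyclic_code N f) (module_vec TYPE('a) N)"
    using L.imT_is_subspace by (simp add: im)
  have "vectorspace.dim class_ring ((module_vec TYPE('a) k)\<lparr>carrier := {0\<^sub>v k}\<rparr>) = 0"
  proof -
    interpret Z: vectorspace class_ring "(module_vec TYPE('a) k)\<lparr>carrier := {0\<^sub>v k}\<rparr>"
      using V.subspace_is_vs[OF L.kerT_is_subspace] by (simp add: ker)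
    have "Z.gen_set {}" 
      using Z.span_empty by (simp add: module_vec_simps)
    then show ?thesis using Z.gen_ge_dim[of "{}"] by simp
  qed
  then show "vectorspace.dim class_ring ((module_vec TYPE('a) N)\<lparr>carrier := cyclic_code N f\<rparr>) = N - degree f"
    using L.rank_nullity[OF V.fin_dim] V.dim_is_n by (simp add: im ker k_def[symmetric])
qed

lemma cyclic_code_smult:
  fixes f :: "'a::field poly"
  assumes "a \<noteq> 0" "f dvd cyc_mod N"
  shows "cyclic_code N (Polynomial.smult a f) = cyclic_code N f"
proof -
  have "Polynomial.smult a f dvd cyc_mod N" using assms by (simp add: smult_dvd_iff)
  then show ?thesis using assms by (auto simp: mem_cyclic_code_iff smult_dvd_iff)
qed

text \<open>Differences of codewords are codewords, so distances are weights. The word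
  \<open>c0\<close> makes the set of distances nonempty, so that its \<open>Min\<close> is
  attained.\<close>

lemma is_code_min_dist:
  fixes C :: "'a::{field,finite} vec set"
  assumes lin: "VectorSpace.subspace class_ring C (module_vec TYPE('a) N)"
      "vectorspace.dim class_ring ((module_vec TYPE('a) N)\<lparr>carrier := C\<rparr>) = k"
    and nz: "c0 \<in> C" "c0 \<noteq> 0\<^sub>v N"
    and wt: "\<And>c. c \<in> C \<Longrightarrow> c \<noteq> 0\<^sub>v N \<Longrightarrow> D \<le> card {i. i < N \<and> c $ i \<noteq> 0}"
  shows "\<exists>d. is_code N k d C \<and> D \<le> d"
proof (intro exI conjI)
  show "is_code N k (min_dist C) C" using lin nz by (auto simp: is_code_def)
  interpret submodule class_ring C "module_vec TYPE('a) N"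
    using lin(1) by (simp add: VectorSpace.subspace_def)
  have CN: "C \<subseteq> carrier_vec N" using subset by (simp add: module_vec_simps)
  have z: "0\<^sub>v N \<in> C" using zero_closed by (simp add: module_vec_simps)
  let ?A = "{hamming_dist u v |u v. u \<in> C \<and> v \<in> C \<and> u \<noteq> v}"
  have "?A \<subseteq> {..N}"
  proof (clarsimp)
    fix u v assume "u \<in> C"
    then have "dim_vec u = N" using CN by auto
    then show "hamming_dist u v \<le> N" unfolding hamming_dist_def
      using card_mono[of "{..<N}" "{i. i < dim_vec u \<and> u $ i \<noteq> v $ i}"] by auto
  qed
  then have fin: "finite ?A" by (rule finite_subset) simp
  have ne: "?A \<noteq> {}" using nz z by auto
  have "D \<le> x" if "x \<in> ?A" for x
  proof -
    from that obtain u v where x: "x = hamming_dist u v" and uv: "u \<in> C" "v \<in> C" "u \<noteq> v" by auto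
    have car: "u \<in> carrier_vec N" "v \<in> carrier_vec N" using CN uv by auto
    have "(-1) \<cdot>\<^sub>v v \<in> C" using smult_closed[of "-1" v] uv by (simp add: module_vec_simps)
    then have "u + (-1) \<cdot>\<^sub>v v \<in> C" using m_closed[of u] uv by (simp add: module_vec_simps)
    also have "u + (-1) \<cdot>\<^sub>v v = u - v" using car by auto
    finally have d: "u - v \<in> C" .
    moreover have "u - v \<noteq> 0\<^sub>v N"
    proof
      assume "u - v = 0\<^sub>v N"
      then have "u $ i = v $ i" if "i < N" for i
        using that car by (metis carrier_vecD eq_iff_diff_eq_0 index_minus_vec(1) index_zero_vec(1))
      then show False using uv car by auto
    qed
    ultimately have "D \<le> card {i. i < N \<and> (u - v) $ i \<noteq> 0}" by (rule wt)
    also have "{i. i < N \<and> (u - v) $ i \<noteq> 0} = {i. i < dim_vec u \<and> u $ i \<noteq> v $ i}"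
      using car by auto
    finally show ?thesis by (simp add: x hamming_dist_def)
  qed
  then show "D \<le> min_dist C" unfolding min_dist_def using Min_in[OF fin ne] by blast
qed

text \<open>If the support of \<open>p\<close> had at most \<open>t\<close> positions, a polynomial \<open>F\<close> of degree less than \<open>t\<close>
  would vanish at \<open>\<beta> ^ i\<close> for all but one position \<open>i\<close> of the support, while
  \<open>\<Sum>i. coeff p i * \<beta> ^ (i * b) * F (\<beta> ^ i)\<close> is a combination of the values of \<open>p\<close> at the
  given consecutive powers of \<open>\<beta>\<close>.\<close>

lemma bch_bound:
  fixes p :: "'a::field poly"
  assumes "p \<noteq> 0" and deg: "degree p < n" and prim: "primitive_root_of_unity n \<beta>"
    and zeros: "\<And>j. j < t \<Longrightarrow> poly p (\<beta> ^ (b + j)) = 0"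
  shows "t < card {i. coeff p i \<noteq> 0}"
proof (rule ccontr)
  define S where "S = {i. coeff p i \<noteq> 0}"
  assume "\<not> t < card {i. coeff p i \<noteq> 0}"
  then have card: "card S \<le> t" by (simp add: S_def)
  have Sn: "S \<subseteq> {..degree p}" by (auto simp: S_def le_degree)
  then have fin: "finite S" by (rule finite_subset) simp
  have n0: "n > 0" using deg by simp
  have \<beta>0: "\<beta> \<noteq> 0" using prim n0 by (auto simp: primitive_root_of_unity_def power_0_left)
  have inj: "\<beta> ^ i \<noteq> \<beta> ^ k" if "i < k" "k < n" for i k
  proof
    assume "\<beta> ^ i = \<beta> ^ k"
    also have "\<beta> ^ k = \<beta> ^ i * \<beta> ^ (k - i)" using that by (simp flip: power_add)
    finally have "\<beta> ^ (k - i) = 1" using \<beta>0 by simp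
    then show False using prim that by (auto simp: primitive_root_of_unity_def)
  qed
  \<comment> \<open>The position left out is the top one, so every other support position is
    smaller, as \<open>inj\<close> requires.\<close>
  define s where "s = degree p"
  have s: "s \<in> S" using \<open>p \<noteq> 0\<close> by (simp add: S_def s_def)
  define F where "F = (\<Prod>i\<in>S - {s}. [:- (\<beta> ^ i), 1:])"
  have "degree F \<le> (\<Sum>i\<in>S - {s}. degree [:- (\<beta> ^ i), 1:])"
    unfolding F_def using fin degree_prod_sum_le[of "S - {s}" "\<lambda>i. [:- (\<beta> ^ i), 1:]"] by simp
  then have "degree F \<le> card (S - {s})" by simp
  moreover have "card (S - {s}) < card S" using s fin by (intro card_Diff1_less)
  ultimately have dF: "degree F < t" using card by simp
  have "(\<Sum>i\<in>S. coeff p i * \<beta> ^ (i * b) * poly F (\<beta> ^ i)) =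
      (\<Sum>i\<in>S. \<Sum>j\<le>degree F. coeff F j * (coeff p i * (\<beta> ^ (b + j)) ^ i))"
    by (intro sum.cong refl, unfold poly_altdef sum_distrib_left)
      (simp add: power_add power_mult_distrib power_mult[symmetric] mult_ac)
  also have "\<dots> = (\<Sum>j\<le>degree F. coeff F j * (\<Sum>i\<in>S. coeff p i * (\<beta> ^ (b + j)) ^ i))"
    by (subst sum.swap) (simp add: sum_distrib_left)
  also have "\<dots> = (\<Sum>j\<le>degree F. coeff F j * poly p (\<beta> ^ (b + j)))"
    unfolding poly_altdef using Sn
    by (intro sum.cong refl arg_cong2[of _ _ _ _ "(*)"] sum.mono_neutral_left) (auto simp: S_def)
  also have "\<dots> = 0" using zeros dF by simp
  also have "(\<Sum>i\<in>S. coeff p i * \<beta> ^ (i * b) * poly F (\<beta> ^ i)) =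
      (\<Sum>i\<in>{s}. coeff p i * \<beta> ^ (i * b) * poly F (\<beta> ^ i))"
    using fin s by (intro sum.mono_neutral_right) (auto simp: F_def poly_prod)
  finally have "poly F (\<beta> ^ s) = 0" using s \<beta>0 by (simp add: S_def)
  then obtain i where i: "i \<in> S" "i \<noteq> s" and "\<beta> ^ s = \<beta> ^ i"
    using fin by (auto simp: F_def poly_prod)
  moreover have "i < s" using i Sn unfolding s_def by (metis atMost_iff le_neq_implies_less subsetD)
  ultimately show False using inj[of i s] deg by (simp add: s_def)
qed

lemma weight_map_word_poly:
  fixes \<phi> :: "'a::field \<Rightarrow> 'b::field"
  assumes "field_hom \<phi>" "c \<in> carrier_vec N"
  shows "card {i. coeff (map_poly \<phi> (word_poly c)) i \<noteq> 0} = card {i. i < N \<and> c $ i \<noteq> 0}"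
proof -
  interpret field_hom \<phi> by (rule assms)
  show ?thesis using assms(2) by (intro arg_cong[of _ _ card]) (auto simp: coeff_word_poly)
qed

text \<open>The words of length \<open>2n\<close> are treated as in the \<open>(u | u + v)\<close> construction: with
  \<open>p = A + x^n B\<close>, either the folded word \<open>A + B\<close> is nonzero and has the zeros of \<open>p\<close>, or
  \<open>p = (x^n - 1) B\<close>, and then the double zeros of \<open>p\<close> are zeros of \<open>B\<close>.\<close>

lemma repeated_root_weight_bound:
  fixes p :: "'a::field poly"
  assumes char2: "(2::'a) = 0" and n: "odd n" and p0: "p \<noteq> 0" and deg: "degree p < 2 * n"
    and prim: "primitive_root_of_unity n \<beta>"
    and zeros: "\<And>j. j < t \<Longrightarrow> poly p (\<beta> ^ j) = 0"
    and double: "\<And>j. j < s \<Longrightarrow> poly (pderiv p) (\<beta> ^ Suc j) = 0"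
  shows "min (t + 1) (2 * (s + 1)) \<le> card {i. coeff p i \<noteq> 0}"
proof -
  define A B where "A = poly_cutoff n p" and "B = poly_shift n p"
  have n0: "n > 0" using n by (cases n) auto
  have cA: "coeff A i = (if i < n then coeff p i else 0)" and cB: "coeff B i = coeff p (i + n)" for i
    by (simp_all add: A_def B_def coeff_poly_cutoff coeff_poly_shift)
  have pAB: "p = A + monom 1 n * B"
    by (auto simp: poly_eq_iff cA cB coeff_monom_mult)
  have fin: "finite {i. coeff p i \<noteq> 0}" for p :: "'a poly"
    using MOST_coeff_eq_0[of p] by (simp add: eventually_cofinite)
  have dAB: "degree (A + B) < n" and dB: "degree B < n"
    using deg n0 by (auto intro!: degree_lessI simp: cA cB coeff_eq_0)
  have sup: "{i. coeff p i \<noteq> 0} = {i. coeff A i \<noteq> 0} \<union> (\<lambda>i. i + n) ` {i. coeff B i \<noteq> 0}"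
  proof (intro equalityI subsetI)
    fix i assume "i \<in> {i. coeff p i \<noteq> 0}"
    then show "i \<in> {i. coeff A i \<noteq> 0} \<union> (\<lambda>i. i + n) ` {i. coeff B i \<noteq> 0}"
      by (cases "i < n") (auto simp: cA cB intro!: image_eqI[of _ _ "i - n"])
  qed (auto simp: cA cB split: if_splits)
  have "{i. coeff A i \<noteq> 0} \<inter> (\<lambda>i. i + n) ` {i. coeff B i \<noteq> 0} = {}"
    by (auto simp: cA split: if_splits)
  then have wt: "card {i. coeff p i \<noteq> 0} = card {i. coeff A i \<noteq> 0} + card {i. coeff B i \<noteq> 0}"
    unfolding sup by (subst card_Un_disjoint) (auto simp: fin card_image inj_on_def)
  have \<beta>n: "\<beta> ^ n = 1" using prim by (simp add: primitive_root_of_unity_def)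
  have \<beta>jn: "(\<beta> ^ j) ^ n = 1" for j
    by (metis \<beta>n mult.commute power_mult power_one)
  show ?thesis
  proof (cases "A + B = 0")
    case False
    \<comment> \<open>Since \<open>x^n\<close> is 1 at every power of \<open>\<beta>\<close>, the
      folded word takes the same values there as \<open>p\<close>.\<close>
    have "t < card {i. coeff (A + B) i \<noteq> 0}"
    proof (rule bch_bound[OF False dAB prim, where b = 0])
      fix j assume "j < t"
      then show "poly (A + B) (\<beta> ^ (0 + j)) = 0"
        using zeros[of j] by (simp add: pAB poly_monom \<beta>jn)
    qed
    also have "\<dots> \<le> card ({i. coeff A i \<noteq> 0} \<union> {i. coeff B i \<noteq> 0})"
      by (intro card_mono finite_UnI fin) auto
    also have "\<dots> \<le> card {i. coeff p i \<noteq> 0}" unfolding wt by (rule card_Un_le)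
    finally show ?thesis by simp
  next
    case True
    then have AB: "A = - B" by (simp add: eq_neg_iff_add_eq_0)
    have pB: "p = cyc_mod n * B" by (subst pAB) (simp add: AB algebra_simps)
    \<comment> \<open>For odd \<open>n\<close> in characteristic 2 the derivative of
      \<open>x^n - 1\<close> is \<open>x^(n-1)\<close>. At a power of \<open>\<beta>\<close> the
      other term of the product rule vanishes, so a zero of \<open>pderiv p\<close> is a zero of
      \<open>B\<close>.\<close>
    have "of_nat n = (1::'a)"
    proof -
      obtain k where "n = 2 * k + 1" using n by (auto elim: oddE)
      then show ?thesis using char2 by simp
    qed
    then have "poly (pderiv p) x = x ^ (n - 1) * poly B x + (x ^ n - 1) * poly (pderiv B) x" for x
      by (simp add: pB pderiv_mult pderiv_diff pderiv_monom poly_monom algebra_simps)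
    then have "(\<beta> ^ Suc j) ^ (n - 1) * poly B (\<beta> ^ Suc j) = 0" if "j < s" for j
      using double[OF that] \<beta>jn[of "Suc j"] by (metis add.right_neutral diff_self mult_zero_left)
    moreover have "\<beta> \<noteq> 0" using \<beta>n n0 by (auto simp: power_0_left)
    ultimately have zB: "poly B (\<beta> ^ (1 + j)) = 0" if "j < s" for j
      using that by fastforce
    have "B \<noteq> 0" using p0 pB by auto
    then have "s < card {i. coeff B i \<noteq> 0}" by (rule bch_bound[OF _ dB prim zB])
    moreover have "card {i. coeff A i \<noteq> 0} = card {i. coeff B i \<noteq> 0}" by (simp add: AB)
    ultimately show ?thesis by (simp add: wt)
  qed
qed

section \<open>Self-duality\<close>

text \<open>Conjugate reciprocation is multiplicative and, by \<open>inv\<close>, an involution on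
  polynomials with nonzero constant term. Up to units it sends \<open>h\<close> to \<open>g'\<close>
  and the cofactor of \<open>g'\<close> back to \<open>g\<close>. The proof keeps track of these
  units.\<close>

lemma self_dual_generator:
  fixes g h :: "'a::field poly"
  assumes \<sigma>: "field_hom (\<lambda>a::'a. a ^ q1)" and inv: "\<And>a::'a. (a ^ q1) ^ q1 = a"
    and char2: "(2::'a) = 0" and n: "n > 0" and g: "lead_coeff g = 1" and gh: "g * h = cyc_mod n"
    and g': "g' = generator_poly n (hermitian_dual q1 n (cyclic_code n g))"
  shows "\<exists>a. a \<noteq> 0 \<and> g' = Polynomial.smult a (map_poly (\<lambda>a. a ^ q1) (reflect_poly h))"
    and "lead_coeff g' = 1" and "g * g' dvd cyc_mod (2 * n)" and "degree (g * g') = n"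
    and "hermitian_self_dual q1 (2 * n) (cyclic_code (2 * n) (g * g'))"
proof -
  interpret field_hom "\<lambda>a::'a. a ^ q1" by (rule \<sigma>)
  interpret M: map_poly_idom_hom "\<lambda>a::'a. a ^ q1" ..
  interpret I: inj_zero_hom "\<lambda>a::'a. a ^ q1" ..
  let ?S = "map_poly (\<lambda>a::'a. a ^ q1)"
  define gs hs where "gs = ?S (reflect_poly g)" and "hs = ?S (reflect_poly h)"
  have "gs * hs = - cyc_mod n"
    unfolding gs_def hs_def by (rule cyc_mod_factor_reflect[OF \<sigma> n gh])
  then have cm: "cyc_mod n = - (gs * hs)" by simp
  have "coeff g 0 * coeff h 0 = - 1"
    using arg_cong[OF gh, of "\<lambda>p. coeff p 0"] n by (simp add: coeff_mult_0)
  then have g0: "coeff g 0 \<noteq> 0" and h0: "coeff h 0 \<noteq> 0" by auto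
  have nz: "g \<noteq> 0" "h \<noteq> 0" "hs \<noteq> 0" using g0 h0 cm cyc_mod_nonzero[OF n, where 'a='a] by auto
  define a where "a = inverse (lead_coeff hs)"
  have a0: "a \<noteq> 0" using nz by (simp add: a_def)
  have hs_dvd: "hs dvd cyc_mod n" unfolding cm by simp
  have dvd: "Polynomial.smult a hs dvd cyc_mod n" using a0 hs_dvd by (simp add: smult_dvd_iff)
  have lead: "lead_coeff (Polynomial.smult a hs) = 1" using nz by (simp add: a_def lead_coeff_smult)
  have g'_eq: "g' = Polynomial.smult a hs"
    using generator_poly_cyclic_code[OF n lead dvd]
    unfolding g' hermitian_dual_cyclic_code[OF \<sigma> n gh] hs_def[symmetric]
    by (simp add: cyclic_code_smult[OF a0 hs_dvd])
  show "\<exists>a. a \<noteq> 0 \<and> g' = Polynomial.smult a (?S (reflect_poly h))"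
    using a0 g'_eq by (auto simp: hs_def)
  show "lead_coeff g' = 1" using lead g'_eq by simp
  \<comment> \<open>The scalar cancels both the normalization of \<open>g'\<close> and the sign in
    \<open>gs * hs = - cyc_mod n\<close>.\<close>
  define h' where "h' = Polynomial.smult (- inverse a) gs"
  have g'h': "g' * h' = cyc_mod n"
    unfolding cm g'_eq h'_def using a0 by (simp add: mult.commute)
  have "cyc_mod (2 * n) = (cyc_mod n :: 'a poly) ^ 2"
  proof -
    have "(2::'a poly) = 0" using char2 by (metis of_nat_0 of_nat_numeral of_nat_poly pCons_0_0)
    then show ?thesis
      by (simp add: power2_eq_square algebra_simps mult_monom mult_2[symmetric] numeral_2_eq_2[symmetric])
  qed
  then have prod: "(g * g') * (h * h') = cyc_mod (2 * n)"
    using gh g'h' by (simp add: power2_eq_square mult_ac)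
  then show gg': "g * g' dvd cyc_mod (2 * n)" by (metis dvd_triv_left)
  have "degree hs = degree h" using h0 by (simp add: hs_def)
  then have "degree (g * g') = degree (g * h)"
    using nz a0 by (simp add: g'_eq degree_mult_eq)
  then show "degree (g * g') = n" using degree_cyc_mod[OF n, where 'a='a] gh by simp
  have SSg: "?S (reflect_poly gs) = g"
    unfolding gs_def reflect_poly_map_poly[OF \<sigma>] reflect_poly_reflect_poly[OF g0]
    by (simp add: poly_eq_iff inv)
  \<comment> \<open>\<open>b\<close> is the unit by which the conjugate reciprocal of
    \<open>h * h'\<close> differs from \<open>g * g'\<close>.\<close>
  define b where "b = (- inverse a) ^ q1 * inverse a"
  have b0: "b \<noteq> 0" using a0 by (simp add: b_def)
  have ab: "a * b = (- inverse a) ^ q1" using a0 by (simp add: b_def mult.left_commute[of a])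
  have "?S (reflect_poly (h * h')) = hs * Polynomial.smult ((- inverse a) ^ q1) g"
    unfolding h'_def reflect_poly_mult M.hom_mult reflect_poly_smult map_poly_hom_smult SSg
    by (simp add: hs_def)
  also have "\<dots> = Polynomial.smult b (g * g')"
    by (simp add: g'_eq ab mult.commute)
  finally have "hermitian_dual q1 (2 * n) (cyclic_code (2 * n) (g * g')) =
      cyclic_code (2 * n) (Polynomial.smult b (g * g'))"
    using hermitian_dual_cyclic_code[OF \<sigma> _ prod] n by simp
  then show "hermitian_self_dual q1 (2 * n) (cyclic_code (2 * n) (g * g'))"
    using cyclic_code_smult[OF b0 gg'] by (simp add: hermitian_self_dual_def)
qed

section \<open>Finite fields and the zeros of BCH codes\<close>

lemma finite_field_power_card:
  fixes x :: "'a::{field,finite}"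
  shows "x ^ CARD('a) = x"
proof (cases "x = 0")
  case True
  then show ?thesis by (simp add: power_0_left)
next
  case False
  let ?U = "UNIV - {0::'a}"
  \<comment> \<open>Multiplication by a nonzero \<open>x\<close> permutes the nonzero
    elements.\<close>
  have "(\<Prod>y\<in>?U. x * y) = (\<Prod>y\<in>?U. y)"
    by (rule prod.reindex_bij_witness[of _ "\<lambda>y. y / x" "\<lambda>y. x * y"]) (use False in auto)
  then have "x ^ card ?U * (\<Prod>y\<in>?U. y) = (\<Prod>y\<in>?U. y)" by (simp add: prod.distrib)
  then have "x ^ card ?U = 1" by simp
  moreover have "CARD('a) = Suc (card ?U)"
    using card_Suc_Diff1[of "UNIV :: 'a set" 0] by simp
  ultimately show ?thesis by (simp only: power_Suc mult_1_right)
qed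

lemma two_eq_zero_if_even_card:
  assumes "even CARD('a::{field,finite})"
  shows "(2::'a) = 0"
proof -
  \<comment> \<open>The even power \<open>CARD('a)\<close> fixes \<open>- 1\<close> but also squares
    its sign away.\<close>
  have "(1::'a) = - 1" using finite_field_power_card[of "- 1 :: 'a"] assms by simp
  then have "(1::'a) + 1 = 0" by (metis add.right_inverse)
  then show ?thesis by simp
qed

lemma field_hom_frobenius:
  assumes "(2::'a::field) = 0"
  shows "field_hom (\<lambda>a::'a. a ^ (2 ^ s))"
proof -
  have "(a + b) ^ (2 ^ s) = a ^ (2 ^ s) + b ^ (2 ^ s)" for a b :: 'a
  proof (induction s)
    case (Suc s)
    have "(a + b) ^ (2 ^ Suc s) = ((a + b) ^ (2 ^ s))\<^sup>2" by (simp add: power_mult[symmetric] mult.commute)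
    also have "\<dots> = (a ^ (2 ^ s))\<^sup>2 + (b ^ (2 ^ s))\<^sup>2" by (simp add: Suc power2_sum assms)
    finally show ?case by (simp add: power_mult[symmetric] mult.commute)
  qed simp
  then show ?thesis by unfold_locales (simp_all add: power_mult_distrib power_0_left)
qed

text \<open>With \<open>q = CARD('a)\<close>, the polynomial \<open>x^q - x\<close> has at most
  \<open>q\<close> roots, and the embedded field already supplies \<open>q\<close> of them.\<close>

lemma fixed_by_power_card_in_range:
  fixes \<phi> :: "'a::{field,finite} \<Rightarrow> 'b::field"
  assumes "field_hom \<phi>" and y: "y ^ CARD('a) = y"
  shows "y \<in> range \<phi>"
proof -
  interpret field_hom \<phi> by (rule assms)
  let ?q = "CARD('a)"
  define P :: "'b poly" where "P = monom 1 ?q - monom 1 1"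
  have q: "?q > 1" using finite_field_power_card[of "0::'a"] card_mono[of UNIV "{0,1::'a}"] by auto
  have "coeff P ?q = 1" using q by (simp add: P_def)
  then have P0: "P \<noteq> 0" by auto
  have dP: "degree P \<le> ?q" unfolding P_def
    using q by (intro degree_diff_le) (auto simp: degree_monom_eq)
  have "range \<phi> \<subseteq> {x. poly P x = 0}"
    by (auto simp: P_def poly_monom hom_power[symmetric] finite_field_power_card)
  moreover have "card {x. poly P x = 0} \<le> card (range \<phi>)"
    using card_poly_roots_bound[OF P0] dP injectivity card_image[of \<phi> UNIV] by (simp add: inj_def)
  ultimately have "range \<phi> = {x. poly P x = 0}"
    by (intro card_seteq poly_roots_finite P0)
  with y show ?thesis by (auto simp: P_def poly_monom)
qed

text \<open>Raising coefficients to the power \<open>CARD('a)\<close> moves each factor to the next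
  and the last to the first. The coefficients of the product are thus fixed and come from the small
  field. The factors may repeat.\<close>

lemma conjugate_poly_descends:
  fixes \<phi> :: "'a::{field,finite} \<Rightarrow> 'b::field" and \<alpha> :: 'b
  assumes \<phi>: "field_hom \<phi>" and frob: "field_hom (\<lambda>x::'b. x ^ CARD('a))"
    and \<alpha>: "\<alpha> ^ (CARD('a) ^ m) = \<alpha>" and m: "m > 0"
  obtains r where "map_poly \<phi> r = (\<Prod>l<m. [:- (\<alpha> ^ (CARD('a) ^ l)), 1:])"
proof -
  interpret field_hom \<phi> by (rule \<phi>)
  interpret Fr: field_hom "\<lambda>x::'b. x ^ CARD('a)" by (rule frob)
  interpret M: map_poly_idom_hom "\<lambda>x::'b. x ^ CARD('a)" ..
  define f where "f = (\<lambda>l. [:- (\<alpha> ^ (CARD('a) ^ l)), 1:])"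
  define R where "R = (\<Prod>l<m. f l)"
  obtain k where k: "m = Suc k" using m by (cases m) auto
  have step: "map_poly (\<lambda>x. x ^ CARD('a)) (f l) = f (Suc l)" for l
  proof -
    have "(- (\<alpha> ^ (CARD('a) ^ l))) ^ CARD('a) = - ((\<alpha> ^ (CARD('a) ^ l)) ^ CARD('a))"
      by (rule Fr.hom_uminus)
    then show ?thesis by (simp add: f_def Fr.map_poly_pCons_hom power_mult[symmetric] mult.commute)
  qed
  have "map_poly (\<lambda>x. x ^ CARD('a)) R = (\<Prod>l<m. f (Suc l))"
    by (simp add: R_def M.hom_prod step)
  also have "\<dots> = (\<Prod>l<k. f (Suc l)) * f m" by (simp add: k)
  also have "f m = f 0" using \<alpha> by (simp add: f_def)
  also have "(\<Prod>l<k. f (Suc l)) * f 0 = R"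
    by (simp add: R_def k prod.lessThan_Suc_shift mult.commute del: prod.lessThan_Suc)
  finally have fixed: "map_poly (\<lambda>x. x ^ CARD('a)) R = R" .
  have "coeff R i ^ CARD('a) = coeff R i" for i
    using arg_cong[OF fixed, of "\<lambda>p. coeff p i"] by simp
  then have cR: "coeff R i \<in> range \<phi>" for i by (rule fixed_by_power_card_in_range[OF \<phi>])
  have inj: "inj \<phi>" by (rule injI) (rule injectivity)
  \<comment> \<open>\<open>map_poly\<close> acts coefficient by coefficient only for maps that send
    0 to 0.\<close>
  have "the_inv \<phi> 0 = 0" using the_inv_f_f[OF inj, of 0] by simp
  then have "map_poly \<phi> (map_poly (the_inv \<phi>) R) = R"
    by (intro poly_eqI) (simp add: coeff_map_poly f_the_inv_into_f[OF inj cR])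
  then show ?thesis using that by (simp add: R_def f_def)
qed

section \<open>Minimal polynomials and monic least common multiples as generators of ideals\<close>

lemma monic_generator_exists:
  fixes P :: "'a::field poly \<Rightarrow> bool"
  assumes "\<exists>r. r \<noteq> 0 \<and> P r" and P: "\<And>r s u. P r \<Longrightarrow> P s \<Longrightarrow> P (r - u * s)"
  obtains p where "lead_coeff p = 1" "P p" "\<And>r. P r \<Longrightarrow> p dvd r"
proof -
  obtain p0 where p0: "p0 \<noteq> 0 \<and> P p0" and
    min: "\<And>r. r \<noteq> 0 \<and> P r \<Longrightarrow> degree p0 \<le> degree r"
    using ex_has_least_nat[of "\<lambda>r. r \<noteq> 0 \<and> P r" _ degree] assms(1) by blast
  have zero: "P 0" using P[of p0 p0 1] p0 by simp
  define p where "p = Polynomial.smult (inverse (lead_coeff p0)) p0"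
  \<comment> \<open>Closure is available for \<open>r - u * s\<close> only, so the scalar multiple
    is written as a difference from 0.\<close>
  have "P (0 - [:- inverse (lead_coeff p0):] * p0)" by (rule P) (use zero p0 in auto)
  then have "P p" by (simp add: p_def)
  moreover have "lead_coeff p = 1" using p0 by (simp add: p_def lead_coeff_smult)
  moreover have "p dvd r" if "P r" for r
  proof -
    have "P (r - r div p0 * p0)" using that p0 by (intro P) auto
    then have *: "P (r mod p0)" by (simp add: minus_div_mult_eq_mod)
    have "r mod p0 = 0"
    proof (rule ccontr)
      assume "r mod p0 \<noteq> 0"
      then show False using min[of "r mod p0"] * degree_mod_less'[of p0 r] p0 by auto
    qed
    then have "p0 dvd r" by auto
    then show ?thesis using p0 by (simp add: p_def smult_dvd_iff)
  qed
  ultimately show ?thesis using that by blast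
qed

text \<open>The polynomials vanishing at \<open>x\<close> form an ideal, and its monic generator is
  the only monic member of least degree. The witness \<open>r0\<close> expresses that
  \<open>x\<close> is algebraic.\<close>

lemma minimal_poly_props:
  fixes \<phi> :: "'a::field \<Rightarrow> 'b::field"
  assumes \<phi>: "field_hom \<phi>" and ex: "r0 \<noteq> 0" "poly (map_poly \<phi> r0) x = 0"
  shows "lead_coeff (minimal_poly \<phi> x) = 1" and "poly (map_poly \<phi> (minimal_poly \<phi> x)) x = 0"
    and "poly (map_poly \<phi> r) x = 0 \<Longrightarrow> minimal_poly \<phi> x dvd r"
proof -
  interpret field_hom \<phi> by (rule \<phi>)
  interpret M: map_poly_idom_hom \<phi> ..
  obtain p where p: "lead_coeff p = 1" "poly (map_poly \<phi> p) x = 0"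
    and pd: "\<And>r. poly (map_poly \<phi> r) x = 0 \<Longrightarrow> p dvd r"
    by (rule monic_generator_exists[of "\<lambda>r. poly (map_poly \<phi> r) x = 0"])
      (use ex in \<open>auto simp: M.hom_minus M.hom_mult\<close>)
  have "minimal_poly \<phi> x = p"
    unfolding minimal_poly_def
  proof (rule the_equality)
    show "lead_coeff p = 1 \<and> poly (map_poly \<phi> p) x = 0 \<and>
        (\<forall>r. r \<noteq> 0 \<and> poly (map_poly \<phi> r) x = 0 \<longrightarrow> degree p \<le> degree r)"
      using p pd by (auto intro: dvd_imp_degree_le)
  next
    fix p' assume p': "lead_coeff p' = 1 \<and> poly (map_poly \<phi> p') x = 0 \<and>
        (\<forall>r. r \<noteq> 0 \<and> poly (map_poly \<phi> r) x = 0 \<longrightarrow> degree p' \<le> degree r)"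
    then have "p dvd p'" by (intro pd) simp
    then obtain u where u: "p' = p * u" by (auto simp: dvd_def)
    have nz: "p \<noteq> 0" "p' \<noteq> 0" "u \<noteq> 0" using p p' u by auto
    then have "degree p' \<le> degree p" using p p' by auto
    then have "degree u = 0" using nz by (simp add: u degree_mult_eq)
    moreover have "lead_coeff u = 1" using p p' u by (simp add: lead_coeff_mult)
    ultimately have "u = 1" by (auto elim!: degree_eq_zeroE simp: one_pCons)
    then show "p' = p" by (simp add: u)
  qed
  then show "lead_coeff (minimal_poly \<phi> x) = 1" "poly (map_poly \<phi> (minimal_poly \<phi> x)) x = 0"
    "poly (map_poly \<phi> r) x = 0 \<Longrightarrow> minimal_poly \<phi> x dvd r"
    using p pd by simp_all
qed

lemma poly_lcm_props:
  fixes A :: "'a::field poly set"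
  assumes "finite A" "0 \<notin> A"
  shows "lead_coeff (poly_lcm A) = 1" and "f \<in> A \<Longrightarrow> f dvd poly_lcm A"
    and "(\<And>f. f \<in> A \<Longrightarrow> f dvd h) \<Longrightarrow> poly_lcm A dvd h"
proof -
  define P where "P = (\<lambda>r. \<forall>f\<in>A. f dvd r)"
  \<comment> \<open>The product of the finitely many nonzero members is a nonzero common
    multiple.\<close>
  have ex: "\<exists>r. r \<noteq> 0 \<and> P r" unfolding P_def
    using assms by (intro exI[of _ "\<Prod>f\<in>A. f"]) (auto intro: dvd_prodI)
  have closed: "P (r - u * s)" if "P r" "P s" for r s u
    using that unfolding P_def by (blast intro: dvd_diff dvd_mult)
  obtain p where p: "lead_coeff p = 1" "P p" and pd: "\<And>h. P h \<Longrightarrow> p dvd h"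
    using monic_generator_exists[OF ex closed] by blast
  note p = p[unfolded P_def] and pd = pd[unfolded P_def]
  have "poly_lcm A = p"
    unfolding poly_lcm_def
  proof (rule the_equality)
    show "lead_coeff p = 1 \<and> (\<forall>f\<in>A. f dvd p) \<and> (\<forall>h. (\<forall>f\<in>A. f dvd h) \<longrightarrow> p dvd h)"
      using p pd by blast
    show "p' = p" if "lead_coeff p' = 1 \<and> (\<forall>f\<in>A. f dvd p') \<and> (\<forall>h. (\<forall>f\<in>A. f dvd h) \<longrightarrow> p' dvd h)" for p'
      using that p pd by (intro monic_dvd_antisym) auto
  qed
  then show "lead_coeff (poly_lcm A) = 1" "f \<in> A \<Longrightarrow> f dvd poly_lcm A"
    "(\<And>f. f \<in> A \<Longrightarrow> f dvd h) \<Longrightarrow> poly_lcm A dvd h"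
    using p pd by simp_all
qed

text \<open>Because \<open>Q ^ (2 * m)\<close> is 1 modulo \<open>Q ^ (2 * m) - 1\<close>,
  multiplying by \<open>Q ^ (2 * m - k)\<close> turns \<open>j + Q ^ k * i\<close> into
  \<open>Q ^ (2 * m - k) * j + i\<close>. As \<open>k\<close> is odd and \<open>m\<close> even,
  \<open>k\<close> differs from \<open>m\<close>, so one of \<open>k\<close> and
  \<open>2 * m - k\<close> is at most \<open>m - 1\<close>. The corresponding sum lies strictly
  between 0 and the modulus.\<close>

lemma bch_zeros_disjoint:
  fixes Q m i j k D :: nat
  assumes Q: "Q > 0" and m: "even m" and k: "odd k" "k < 2 * m" and i: "0 < i" "i \<le> D"
    and low: "j + D * Q ^ (m - 1) < Q ^ (2 * m) - 1" and high: "j * Q ^ (m - 1) + D < Q ^ (2 * m) - 1"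
  shows "\<not> (Q ^ (2 * m) - 1) dvd j + Q ^ k * i"
proof
  define n where "n = Q ^ (2 * m) - 1"
  have n: "Q ^ (2 * m) = Suc n" using Q by (simp add: n_def)
  assume "(Q ^ (2 * m) - 1) dvd j + Q ^ k * i"
  then have dvd: "n dvd j + Q ^ k * i" by (simp add: n_def)
  show False
  proof (cases "k \<le> m - 1")
    case True
    have "Q ^ k * i \<le> Q ^ (m - 1) * D" using True Q i by (intro mult_le_mono power_increasing) auto
    then have "j + Q ^ k * i < n" using low by (simp add: mult.commute n_def)
    moreover have "0 < j + Q ^ k * i" using Q i by simp
    ultimately show False using dvd by (simp add: nat_dvd_not_less)
  next
    case False
    then have k': "2 * m - k \<le> m - 1" using k m by (cases "k = m") auto
    have "n dvd Q ^ (2 * m - k) * (j + Q ^ k * i)" using dvd by simp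
    also have "Q ^ (2 * m - k) * (j + Q ^ k * i) = Q ^ (2 * m - k) * j + Q ^ (2 * m) * i"
      using k by (simp add: distrib_left mult.assoc[symmetric] flip: power_add)
    also note n
    also have "Q ^ (2 * m - k) * j + Suc n * i = (Q ^ (2 * m - k) * j + i) + n * i" by simp
    finally have "n dvd Q ^ (2 * m - k) * j + i" by (simp only: dvd_add_left_iff dvd_triv_left)
    moreover have "Q ^ (2 * m - k) * j \<le> Q ^ (m - 1) * j"
      using k' Q by (intro mult_le_mono power_increasing) auto
    then have "Q ^ (2 * m - k) * j + i < n" using high[unfolded mult.commute[of j]] i unfolding n_def by linarith
    ultimately show False using i by (simp add: nat_dvd_not_less)
  qed
qed

lemma primitive_root_power_eq_1_iff:
  assumes "primitive_root_of_unity n \<beta>" "n > 0"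
  shows "\<beta> ^ e = 1 \<longleftrightarrow> n dvd e"
proof -
  have \<beta>: "\<beta> ^ n = 1" using assms by (simp add: primitive_root_of_unity_def)
  have "\<beta> ^ e = \<beta> ^ (n * (e div n) + e mod n)" by simp
  also have "\<dots> = \<beta> ^ (e mod n)" by (simp only: power_add power_mult \<beta> power_one mult_1)
  finally have "\<beta> ^ e = 1 \<longleftrightarrow> \<beta> ^ (e mod n) = 1" by simp
  also have "\<dots> \<longleftrightarrow> e mod n = 0"
    using assms by (metis mod_less_divisor neq0_conv power_0 primitive_root_of_unity_def)
  finally show ?thesis by (simp add: dvd_eq_mod_eq_0)
qed

text \<open>For each \<open>i\<close> the product over the conjugates of \<open>\<beta> ^ i\<close>
  descends to the small field and is a multiple of the minimal polynomial. \<open>G\<close> divides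
  the product of these over all \<open>i\<close>, which confines its zeros to conjugates.\<close>

lemma bch_generator_props:
  fixes \<phi> :: "'a::{field,finite} \<Rightarrow> 'b::field" and \<beta> :: 'b and D :: nat
  assumes \<phi>: "field_hom \<phi>" and frob: "field_hom (\<lambda>x::'b. x ^ CARD('a))"
    and \<beta>q: "\<beta> ^ (CARD('a) ^ m) = \<beta>" and m: "m > 0" and \<beta>n: "\<beta> ^ n = 1" and n: "n > 0"
  defines "G \<equiv> poly_lcm ((\<lambda>i. minimal_poly \<phi> (\<beta> powi i)) ` {1..int D})"
  shows "lead_coeff G = 1" and "G dvd cyc_mod n"
    and "0 < i \<Longrightarrow> i \<le> D \<Longrightarrow> poly (map_poly \<phi> G) (\<beta> ^ i) = 0"
    and "poly (map_poly \<phi> G) \<gamma> = 0 \<Longrightarrow> \<exists>i l. 0 < i \<and> i \<le> D \<and> l < m \<and> \<gamma> = \<beta> ^ (i * CARD('a) ^ l)"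
proof -
  interpret field_hom \<phi> by (rule \<phi>)
  interpret M: map_poly_idom_hom \<phi> ..
  have G: "G = poly_lcm ((\<lambda>i. minimal_poly \<phi> (\<beta> ^ i)) ` {1..D})"
    unfolding G_def by (simp add: image_int_atLeastAtMost[of 1 D, simplified, symmetric] image_image)
  \<comment> \<open>\<open>x^n - 1\<close> serves as the witness that every
    \<open>\<beta> ^ i\<close> is algebraic.\<close>
  have xn: "poly (map_poly \<phi> (cyc_mod n)) (\<beta> ^ i) = 0" for i
    by (simp add: M.hom_minus \<beta>n poly_monom power_mult[symmetric] mult.commute[of i])
      (simp add: power_mult \<beta>n)
  note min = minimal_poly_props[OF \<phi> cyc_mod_nonzero[OF n] xn]
  have nz: "minimal_poly \<phi> (\<beta> ^ i) \<noteq> 0" for i using min(1)[of i] by auto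
  have "finite ((\<lambda>i. minimal_poly \<phi> (\<beta> ^ i)) ` {1..D})" "0 \<notin> (\<lambda>i. minimal_poly \<phi> (\<beta> ^ i)) ` {1..D}"
    using nz by force+
  note lcm = poly_lcm_props[OF this, folded G]
  show "lead_coeff G = 1" by (rule lcm(1))
  show "G dvd cyc_mod n" by (rule lcm(3)) (use min(3) xn in auto)
  show "poly (map_poly \<phi> G) (\<beta> ^ i) = 0" if "0 < i" "i \<le> D"
  proof -
    have "minimal_poly \<phi> (\<beta> ^ i) dvd G" using that by (intro lcm(2)) auto
    then have "map_poly \<phi> (minimal_poly \<phi> (\<beta> ^ i)) dvd map_poly \<phi> G" by (rule M.hom_dvd)
    then show ?thesis using min(2)[of i] by (auto simp: dvd_def)
  qed
  show "\<exists>i l. 0 < i \<and> i \<le> D \<and> l < m \<and> \<gamma> = \<beta> ^ (i * CARD('a) ^ l)"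
    if "poly (map_poly \<phi> G) \<gamma> = 0"
  proof -
    have "\<exists>r. map_poly \<phi> r = (\<Prod>l<m. [:- ((\<beta> ^ i) ^ (CARD('a) ^ l)), 1:])" for i
    proof -
      have "(\<beta> ^ i) ^ (CARD('a) ^ m) = \<beta> ^ i"
        by (metis \<beta>q mult.commute power_mult)
      then show ?thesis using conjugate_poly_descends[OF \<phi> frob _ m] by metis
    qed
    then obtain r where r: "\<And>i. map_poly \<phi> (r i) = (\<Prod>l<m. [:- ((\<beta> ^ i) ^ (CARD('a) ^ l)), 1:])"
      by metis
    have "poly (map_poly \<phi> (r i)) (\<beta> ^ i) = 0" for i
      unfolding r poly_prod using m by (auto intro!: bexI[of _ 0])
    then have "minimal_poly \<phi> (\<beta> ^ i) dvd r i" for i by (rule min(3))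
    then have "G dvd (\<Prod>i\<in>{1..D}. r i)"
      by (intro lcm(3)) (auto intro: dvd_trans dvd_prodI)
    then have "map_poly \<phi> G dvd (\<Prod>i\<in>{1..D}. map_poly \<phi> (r i))"
      unfolding M.hom_prod[symmetric] by (rule M.hom_dvd)
    then have "poly (\<Prod>i\<in>{1..D}. map_poly \<phi> (r i)) \<gamma> = 0" using that by (auto simp: dvd_def)
    then obtain i l where "i \<in> {1..D}" "l < m" "\<gamma> = (\<beta> ^ i) ^ (CARD('a) ^ l)"
      by (auto simp: r poly_prod)
    then show ?thesis by (intro exI[of _ i] exI[of _ l]) (simp add: power_mult)
  qed
qed

text \<open>A zero \<open>inverse \<gamma>\<close> of \<open>x^n - 1\<close> missed by
  \<open>g\<close> is a zero of \<open>h\<close>. Reciprocation moves it to \<open>\<gamma>\<close>,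
  and conjugating the coefficients moves it to \<open>\<gamma> ^ q1\<close>.\<close>

lemma hermitian_dual_generator_zero:
  fixes \<phi> :: "'a::field \<Rightarrow> 'b::field"
  assumes \<phi>: "field_hom \<phi>" and \<sigma>: "field_hom (\<lambda>a::'a. a ^ q1)" and \<tau>: "field_hom (\<lambda>x::'b. x ^ q1)"
    and n: "n > 0" and gh: "g * h = cyc_mod n" and \<gamma>: "\<gamma> ^ n = 1"
    and nz: "poly (map_poly \<phi> g) (inverse \<gamma>) \<noteq> 0"
  shows "poly (map_poly \<phi> (map_poly (\<lambda>a. a ^ q1) (reflect_poly h))) (\<gamma> ^ q1) = 0"
proof -
  interpret field_hom \<phi> by (rule \<phi>)
  interpret M: map_poly_idom_hom \<phi> ..
  interpret S: field_hom "\<lambda>a::'a. a ^ q1" by (rule \<sigma>)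
  interpret T: field_hom "\<lambda>x::'b. x ^ q1" by (rule \<tau>)
  have \<gamma>0: "\<gamma> \<noteq> 0" using \<gamma> n by (auto simp: power_0_left)
  have "map_poly \<phi> g * map_poly \<phi> h = cyc_mod n"
    by (simp add: M.hom_mult[symmetric] gh M.hom_minus)
  then have "poly (map_poly \<phi> g) (inverse \<gamma>) * poly (map_poly \<phi> h) (inverse \<gamma>) = 0"
    by (metis \<gamma> diff_self inverse_1 poly_cyc_mod poly_mult power_inverse)
  then have "poly (map_poly \<phi> h) (inverse \<gamma>) = 0" using nz by simp
  then have z: "poly (reflect_poly (map_poly \<phi> h)) \<gamma> = 0"
    using \<gamma>0 by (simp add: poly_reflect_poly_nz)
  have "map_poly \<phi> (map_poly (\<lambda>a. a ^ q1) (reflect_poly h)) =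
      map_poly (\<lambda>x. x ^ q1) (reflect_poly (map_poly \<phi> h))"
    unfolding reflect_poly_map_poly[OF \<phi>] by (rule poly_eqI) (simp add: hom_power)
  then show ?thesis using z T.poly_map_poly[of "reflect_poly (map_poly \<phi> h)" \<gamma>] T.hom_zero by simp
qed

section \<open>The self-dual code of length \<open>2n\<close> and its minimum distance\<close>

theorem theorem10:
  fixes \<phi> :: "'a::{field, finite} \<Rightarrow> 'b::{field, finite}"
    and \<beta> :: 'b
    and s q1 q m n :: nat
    and \<delta> :: int
    and g g' :: "'a poly"
    and C' :: "'a vec set"
  assumes "s \<ge> 1" and "q1 = 2 ^ s"
    and "q = q1 ^ 2"
    and "even m"
    and "n = q ^ m - 1"
    and "CARD('a) = q"
    and "CARD('b) = q ^ m"
    and "field_hom \<phi>"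
    and "primitive_root_of_unity n \<beta>"
    and "\<delta> = int q1 ^ (m + 1) - int q1 ^ 2 + 1"
    and "\<delta> \<ge> 2"
    and "g = generator_poly n (bch_code \<phi> n \<delta> 1 \<beta>)"
    and "g' = generator_poly n (hermitian_dual q1 n (bch_code \<phi> n \<delta> 1 \<beta>))"
    and "C' = cyclic_code (2 * n) (g * g')"
  shows "is_cyclic_code (2 * n) C' \<and> is_generator_poly (2 * n) C' (g * g') \<and>
    hermitian_self_dual q1 (2 * n) C' \<and>
    (m \<ge> 4 \<longrightarrow> (\<exists>d. is_code (2 * (q ^ m - 1)) (q ^ m - 1) d C' \<and>
       int d \<ge> int q1 ^ (m + 1) - int q1 ^ 2 + 2)) \<and>
    (m = 2 \<longrightarrow> (\<exists>d. is_code (2 * (q ^ 2 - 1)) (q ^ 2 - 1) d C' \<and>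
       int d \<ge> int q1 ^ 3 - int q1 ^ 2 + int q1 + 1))"
proof -
  note q1 = assms(2) and q = assms(3) and n_eq = assms(5) and \<phi> = assms(8) and prim = assms(9)
    and \<delta> = assms(10) and C' = assms(14)
  interpret field_hom \<phi> by (rule \<phi>)
  interpret M: map_poly_idom_hom \<phi> ..
  interpret inj_zero_hom \<phi> ..
  have q1_2: "q1 \<ge> 2" using assms(1) q1 self_le_power[of 2 s] by simp
  \<comment> \<open>For \<open>m = 0\<close> the designed distance would be
    \<open>q1 - q1^2 + 1\<close>, which is below 2.\<close>
  have m0: "m \<noteq> 0"
  proof
    assume "m = 0"
    then have "int q1 - int q1 * int q1 \<ge> 1" using \<delta> assms(11) by (simp add: power2_eq_square)
    moreover have "int q1 * 1 \<le> int q1 * int q1" using q1_2 by (intro mult_left_mono) auto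
    ultimately show False by simp
  qed
  then have m2: "m \<ge> 2" using assms(4) by (cases "m = 1") auto
  have qm: "q ^ m = q1 ^ (2 * m)" by (simp add: q power_mult)
  have qm_Suc: "q1 ^ (2 * m) = Suc n" using q1_2 by (simp add: n_eq qm)
  have "even (q1 ^ (2 * m))" using q1 assms(1) m0 by simp
  then have odd: "odd n" unfolding qm_Suc by simp
  then have n0: "n > 0" by (cases n) auto
  have char_a: "(2::'a) = 0" and char_b: "(2::'b) = 0"
    using two_eq_zero_if_even_card[where 'a='a] two_eq_zero_if_even_card[where 'a='b]
      assms(1,6,7) q q1 m0 by simp_all
  have \<sigma>: "field_hom (\<lambda>a::'a. a ^ q1)" and \<tau>: "field_hom (\<lambda>x::'b. x ^ q1)"
    using field_hom_frobenius[OF char_a, of s] field_hom_frobenius[OF char_b, of s] q1 by simp_all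
  have frob: "field_hom (\<lambda>x::'b. x ^ CARD('a))"
    using field_hom_frobenius[OF char_b, of "s * 2"] by (simp add: assms(6) q q1 power_mult)
  have inv: "(a ^ q1) ^ q1 = a" for a :: 'a
    using finite_field_power_card[of a] by (simp add: assms(6) q power2_eq_square power_mult)
  have \<beta>n: "\<beta> ^ n = 1" using prim by (simp add: primitive_root_of_unity_def)
  have \<beta>0: "\<beta> \<noteq> 0" using \<beta>n n0 by (auto simp: power_0_left)
  have \<beta>q: "\<beta> ^ (q ^ m) = \<beta>" using finite_field_power_card[of \<beta>] by (simp add: assms(7))
  note order = primitive_root_power_eq_1_iff[OF prim n0]

  \<comment> \<open>\<open>D\<close> is \<open>\<delta> - 1\<close>, the last exponent in the BCH
    range. The subtraction is not truncated because \<open>m + 1\<close> is at least 2.\<close>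
  define D where "D = q1 ^ (m + 1) - q1 ^ 2"
  have D: "D + q1 ^ 2 = q1 ^ (m + 1)"
    using power_increasing[of 2 "m + 1" q1] q1_2 m2 by (simp add: D_def)
  have "int D + int q1 ^ 2 = int q1 ^ (m + 1)" using arg_cong[OF D, of int] by simp
  then have \<delta>D: "\<delta> = int D + 1" using \<delta> by simp
  define G where "G = poly_lcm ((\<lambda>i. minimal_poly \<phi> (\<beta> powi i)) ` {1..int D})"
  note bch = bch_generator_props[OF \<phi> frob _ _ \<beta>n n0, where m = m and D = D, folded G_def, unfolded assms(6), OF \<beta>q]
  have code: "bch_code \<phi> n \<delta> 1 \<beta> = cyclic_code n G"
    by (simp add: bch_code_def G_def \<delta>D)
  have gG: "g = G" unfolding assms(12) code using m0 by (intro generator_poly_cyclic_code n0 bch) auto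
  have "g dvd cyc_mod n" using bch(2) m0 by (simp add: gG)
  then obtain h where gh: "g * h = cyc_mod n" by (metis dvdE)
  have g_lead: "lead_coeff g = 1" using bch(1) m0 by (simp add: gG)
  have g': "g' = generator_poly n (hermitian_dual q1 n (cyclic_code n g))"
    using assms(13) by (simp add: code gG)
  note sd = self_dual_generator[OF \<sigma> inv char_a n0 g_lead gh g']
  obtain a where g'_eq: "g' = Polynomial.smult a (map_poly (\<lambda>a. a ^ q1) (reflect_poly h))"
    using sd(1) by auto

  have g'_zero: "poly (map_poly \<phi> g') (\<beta> ^ j) = 0"
    if low: "j + D * q1 ^ (m - 1) < n" and high: "j * q1 ^ (m - 1) + D < n" for j
  proof -
    \<comment> \<open>\<open>\<gamma>\<close> is a \<open>q1\<close>-th root of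
      \<open>\<beta> ^ j\<close>: the exponent gains a factor \<open>q1 ^ (2 * m) = q ^ m\<close>,
      which fixes \<open>\<beta>\<close>.\<close>
    define \<gamma> where "\<gamma> = \<beta> ^ (j * q1 ^ (2 * m - 1))"
    have "\<gamma> ^ q1 = \<beta> ^ (j * (q1 ^ (2 * m - 1) * q1))" by (simp add: \<gamma>_def power_mult)
    also have "q1 ^ (2 * m - 1) * q1 = q ^ m" using m0 by (simp add: qm flip: power_Suc2)
    also have "\<beta> ^ (j * q ^ m) = \<beta> ^ j" by (metis \<beta>q mult.commute power_mult)
    finally have \<gamma>q: "\<gamma> ^ q1 = \<beta> ^ j" .
    have \<gamma>n: "\<gamma> ^ n = 1" by (metis \<beta>n \<gamma>_def mult.commute power_mult power_one)
    have "poly (map_poly \<phi> g) (inverse \<gamma>) \<noteq> 0"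
    proof
      assume "poly (map_poly \<phi> g) (inverse \<gamma>) = 0"
      then obtain i l where il: "0 < i" "i \<le> D" "l < m" "inverse \<gamma> = \<beta> ^ (i * q ^ l)"
        using bch(4) m0 unfolding gG by blast
      have \<gamma>0: "\<gamma> \<noteq> 0" using \<beta>0 by (simp add: \<gamma>_def)
      \<comment> \<open>Raising \<open>inverse \<gamma> = \<beta> ^ (i * q ^ l)\<close> to the power
        \<open>q1\<close> yields the odd exponent \<open>2 * l + 1\<close> of
        \<open>q1\<close>.\<close>
      have "\<beta> ^ (j + q1 ^ (2 * l + 1) * i) = \<gamma> ^ q1 * (\<beta> ^ (i * q ^ l)) ^ q1"
        by (simp add: \<gamma>q power_add q power_mult[symmetric] mult_ac)
      also have "\<dots> = (\<gamma> * inverse \<gamma>) ^ q1" by (simp add: il(4) power_mult_distrib)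
      also have "\<dots> = 1" using \<gamma>0 by simp
      finally have "n dvd j + q1 ^ (2 * l + 1) * i" by (simp add: order)
      moreover have "\<not> (q1 ^ (2 * m) - 1) dvd j + q1 ^ (2 * l + 1) * i"
        by (rule bch_zeros_disjoint[where D = D])
          (use il low high assms(4) q1_2 in \<open>auto simp: qm_Suc\<close>)
      ultimately show False by (simp add: qm_Suc)
    qed
    then have "poly (map_poly \<phi> (map_poly (\<lambda>a. a ^ q1) (reflect_poly h))) (\<gamma> ^ q1) = 0"
      by (rule hermitian_dual_generator_zero[OF \<phi> \<sigma> \<tau> n0 gh \<gamma>n])
    then show ?thesis by (simp add: g'_eq \<gamma>q map_poly_hom_smult)
  qed

  \<comment> \<open>Multiplying \<open>D + q1 ^ 2 = q1 ^ (m + 1)\<close> by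
    \<open>q1 ^ (m - 1)\<close> shows how far \<open>D * q1 ^ (m - 1)\<close> stays below
    \<open>n\<close>.\<close>
  have DQ: "D * q1 ^ (m - 1) + q1 ^ (m + 1) = Suc n"
  proof -
    have "(D + q1 ^ 2) * q1 ^ (m - 1) = q1 ^ (m + 1 + (m - 1))" by (simp only: D power_add)
    also have "m + 1 + (m - 1) = 2 * m" using m2 by simp
    finally have "D * q1 ^ (m - 1) + q1 ^ (2 + (m - 1)) = Suc n"
      by (simp only: distrib_right power_add qm_Suc)
    moreover have "2 + (m - 1) = m + 1" using m2 by simp
    ultimately show ?thesis by metis
  qed
  have q1_sq: "q1 < q1 ^ 2" using q1_2 by (simp add: power2_eq_square)
  have g'_low: "poly (map_poly \<phi> g') (\<beta> ^ j) = 0" if "j \<le> D" for j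
  proof (rule g'_zero)
    \<comment> \<open>For \<open>j \<le> D\<close> both size conditions follow from
      \<open>D * q1 ^ (m - 1) + D < n\<close>.\<close>
    have "D + 1 < q1 ^ (m + 1)" using D q1_sq q1_2 by simp
    then have "D * q1 ^ (m - 1) + D < n" using DQ by simp
    moreover have "j * q1 ^ (m - 1) \<le> D * q1 ^ (m - 1)" using that by simp
    ultimately show "j + D * q1 ^ (m - 1) < n" "j * q1 ^ (m - 1) + D < n" using that by linarith+
  qed

  \<comment> \<open>The two distance bounds differ only in the number \<open>t\<close> of
    consecutive zeros of \<open>g'\<close> starting at \<open>\<beta> ^ 0\<close>; the
    \<open>D\<close> double zeros are the same.\<close>
  have params: "\<exists>d. is_code (2 * n) n d C' \<and> min (t + 1) (2 * (D + 1)) \<le> d"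
    if zeros: "\<And>j. j < t \<Longrightarrow> poly (map_poly \<phi> g') (\<beta> ^ j) = 0" for t
  proof (rule is_code_min_dist)
    show "VectorSpace.subspace class_ring C' (module_vec TYPE('a) (2 * n))"
      unfolding C' using n0 by (intro cyclic_code_linear sd) simp
    show "vectorspace.dim class_ring (module_vec TYPE('a) (2 * n)\<lparr>carrier := C'\<rparr>) = n"
      unfolding C' using n0 sd(3,4) by (subst cyclic_code_linear(2)) auto
    define c0 where "c0 = vec (2 * n) (coeff (g * g'))"
    have w0: "word_poly c0 = g * g'"
      unfolding c0_def using n0 sd(4) by (intro word_poly_vec) simp
    show "c0 \<in> C'" unfolding C' mem_cyclic_code_iff[OF sd(3)] by (simp add: w0) (simp add: c0_def)
    show "c0 \<noteq> 0\<^sub>v (2 * n)"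
    proof
      assume "c0 = 0\<^sub>v (2 * n)"
      then have "g * g' = 0" using w0 by simp
      then show False using g_lead sd(2) by auto
    qed
    fix c assume "c \<in> C'" and c0: "c \<noteq> 0\<^sub>v (2 * n)"
    then have c: "c \<in> carrier_vec (2 * n)" and "g * g' dvd word_poly c"
      by (simp_all add: C' mem_cyclic_code_iff[OF sd(3)])
    then obtain u where u: "word_poly c = g * g' * u" by (auto simp: dvd_def)
    define p where "p = map_poly \<phi> (word_poly c)"
    have p: "p = map_poly \<phi> g * map_poly \<phi> g' * map_poly \<phi> u" by (simp add: p_def u M.hom_mult)
    have "word_poly c \<noteq> 0" using c0 c word_poly_eq_iff[OF c zero_carrier_vec] by simp
    then have "p \<noteq> 0" by (simp add: p_def)
    moreover have "degree p < 2 * n" using degree_word_poly[OF _ c] n0 by (simp add: p_def)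
    moreover have "poly p (\<beta> ^ j) = 0" if "j < t" for j using zeros[OF that] by (simp add: p)
    \<comment> \<open>Both \<open>g\<close> and \<open>g'\<close> vanish at this point, so every
      term of the product rule keeps a vanishing factor.\<close>
    moreover have "poly (pderiv p) (\<beta> ^ Suc j) = 0" if "j < D" for j
      using bch(3)[of "Suc j"] g'_low[of "Suc j"] that m0 by (simp add: p pderiv_mult gG)
    ultimately have "min (t + 1) (2 * (D + 1)) \<le> card {i. coeff p i \<noteq> 0}"
      using char_b odd prim by (intro repeated_root_weight_bound) auto
    then show "min (t + 1) (2 * (D + 1)) \<le> card {i. i < 2 * n \<and> c $ i \<noteq> 0}"
      using weight_map_word_poly[OF \<phi> c] by (simp add: p_def)
  qed

  have "\<exists>d. is_code (2 * (q ^ m - 1)) (q ^ m - 1) d C' \<and>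
      int d \<ge> int q1 ^ (m + 1) - int q1 ^ 2 + 2"
  proof -
    \<comment> \<open>The zeros \<open>\<beta> ^ 0\<close> to \<open>\<beta> ^ D\<close> give
      \<open>t = D + 1\<close>, and the minimum is \<open>D + 2 = \<delta> + 1\<close>.\<close>
    obtain d where "is_code (2 * n) n d C'" "min (D + 1 + 1) (2 * (D + 1)) \<le> d"
      using params[of "D + 1"] g'_low by auto
    then show ?thesis using \<delta> \<delta>D n_eq by (intro exI[of _ d]) auto
  qed
  moreover have "\<exists>d. is_code (2 * (q ^ 2 - 1)) (q ^ 2 - 1) d C' \<and>
      int d \<ge> int q1 ^ 3 - int q1 ^ 2 + int q1 + 1" if m: "m = 2"
  proof -
    have D2: "D + q1 ^ 2 = q1 ^ 3" and DQ2: "D * q1 + q1 ^ 3 = Suc n" using D DQ m by simp_all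
    \<comment> \<open>The range is the largest these estimates allow: at \<open>j = D + q1\<close>
      the value \<open>j * q1 + D\<close> would be \<open>n + 1\<close>.\<close>
    have "poly (map_poly \<phi> g') (\<beta> ^ j) = 0" if j: "j < D + q1" for j
    proof (rule g'_zero)
      show "j + D * q1 ^ (m - 1) < n" using j D2 DQ2 q1_sq by (simp add: m)
      have "Suc j * q1 \<le> (D + q1) * q1" using j by (intro mult_le_mono) auto
      then have "j * q1 + q1 \<le> D * q1 + q1 ^ 2" by (simp add: algebra_simps power2_eq_square)
      then show "j * q1 ^ (m - 1) + D < n" using D2 DQ2 q1_2 by (simp add: m)
    qed
    then obtain d where d: "is_code (2 * n) n d C'" "min (D + q1 + 1) (2 * (D + 1)) \<le> d"
      using params by blast
    \<comment> \<open>This leads to \<open>q1 \<le> D\<close>, so that \<open>D + q1 + 1\<close> is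
      the smaller entry of the minimum.\<close>
    have "q1 ^ 2 * 2 \<le> q1 ^ 2 * q1" using q1_2 by (intro mult_le_mono) auto
    then have "q1 ^ 2 * 2 \<le> q1 ^ 3" by (simp add: power3_eq_cube power2_eq_square mult.assoc)
    then have "q1 \<le> D" using D2 q1_sq by simp
    then have "D + q1 + 1 \<le> d" using d(2) by simp
    moreover have "int D + int q1 ^ 2 = int q1 ^ 3" using arg_cong[OF D2, of int] by simp
    ultimately show ?thesis using d(1) n_eq m by (intro exI[of _ d]) auto
  qed
  moreover have "is_cyclic_code (2 * n) C'"
    unfolding C' using n0 by (intro is_cyclic_code_cyclic_code) simp
  moreover have "is_generator_poly (2 * n) C' (g * g')"
    unfolding C' using n0 g_lead sd(2,3)
    by (intro is_generator_poly_cyclic_code) (simp_all only: lead_coeff_mult, simp_all)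
  ultimately show ?thesis using sd(5) by (simp add: C')
qed

end
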